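(* Let $\alpha,\beta>-1$, let $f:[0,1]\to\mathbb R$ be differentiable with $f'$ continuous on $[0,1]$, and let $(q_n)$ be a sequence in $(0,1)$ with $1-q_n=o(1/n^4)$ as $n\to\infty$. Then $$\lim_{n\to\infty}\left(M_{n,q_n}^{\alpha,\beta}f\right)'(x)=f'(x)\quad\text{uniformly on }[0,1],$$ where $'$ denotes the ordinary derivative.
   Context: For $q\in(0,1)$ and real $a$, $[a]_q=\frac{1-q^a}{1-q}$; $[n]_q!=\prod_{j=1}^n[j]_q$; $\begin{bmatrix}n\\k\end{bmatrix}_q=\frac{[n]_q!}{[k]_q!\,[n-k]_q!}$. For real $a$, $(1-x)_q^a=\prod_{j=0}^\infty\frac{1-q^jx}{1-q^{j+a}x}$. The Jackson integral is $\int_0^ah(t)\,d_qt=a(1-q)\sum_{i\ge0}q^ih(q^ia)$. Put $b_{n,k,q}(x)=\begin{bmatrix}n\\k\end{bmatrix}_qx^k(1-x)_q^{n-k}$, $0\le k\le n$, and $$M_{n,q}^{\alpha,\beta}f(x)=\sum_{k=0}^n f_{n,k,q}^{\alpha,\beta}\,b_{n,k,q}(x),\qquad f_{n,k,q}^{\alpha,\beta}=\frac{\int_0^1t^{k+\alpha}(1-qt)_q^{n-k+\beta}f(q^{\beta+1}t)\,d_qt}{\int_0^1t^{k+\alpha}(1-qt)_q^{n-k+\beta}\,d_qt}.$$ *)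

theory Defs
  imports "HOL-Analysis.Analysis" "HOL-Library.Landau_Symbols"
begin

definition q_num :: "real \<Rightarrow> real \<Rightarrow> real" where
  "q_num q a = (1 - q powr a) / (1 - q)"

definition q_fact :: "real \<Rightarrow> nat \<Rightarrow> real" where
  "q_fact q n = (\<Prod>j=1..n. q_num q (real j))"

definition q_binomial :: "real \<Rightarrow> nat \<Rightarrow> nat \<Rightarrow> real" where
  "q_binomial q n k = q_fact q n / (q_fact q k * q_fact q (n - k))"

(* (1 - x)_q^a as an infinite product.  For a natural exponent a the product telescopes to a
   polynomial in x, but a factor can read 0/0 (e.g. a = 0, x = 1), which division in HOL would
   turn into 0.  The polynomial is therefore taken as the value for natural a; by q_pow_eq_prodinf
   below it agrees with the infinite product whenever no denominator vanishes. *)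
definition q_pow :: "real \<Rightarrow> real \<Rightarrow> real \<Rightarrow> real" where
  "q_pow q a x =
     (if a \<in> \<nat> then (\<Prod>j<nat \<lfloor>a\<rfloor>. 1 - q ^ j * x)
      else (\<Prod>j. (1 - q ^ j * x) / (1 - q powr (real j + a) * x)))"

definition jackson_integral :: "real \<Rightarrow> real \<Rightarrow> (real \<Rightarrow> real) \<Rightarrow> real" where
  "jackson_integral q a h = a * (1 - q) * (\<Sum>i. q ^ i * h (q ^ i * a))"

definition q_bernstein :: "nat \<Rightarrow> nat \<Rightarrow> real \<Rightarrow> real \<Rightarrow> real" where
  "q_bernstein n k q x = q_binomial q n k * x ^ k * q_pow q (real (n - k)) x"

definition q_durrmeyer_coeff ::
    "nat \<Rightarrow> nat \<Rightarrow> real \<Rightarrow> real \<Rightarrow> real \<Rightarrow> (real \<Rightarrow> real) \<Rightarrow> real" where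
  "q_durrmeyer_coeff n k q \<alpha> \<beta> f =
     jackson_integral q 1 (\<lambda>t. t powr (real k + \<alpha>) * q_pow q (real (n - k) + \<beta>) (q * t)
                                 * f (q powr (\<beta> + 1) * t))
     / jackson_integral q 1 (\<lambda>t. t powr (real k + \<alpha>) * q_pow q (real (n - k) + \<beta>) (q * t))"

definition q_durrmeyer ::
    "nat \<Rightarrow> real \<Rightarrow> real \<Rightarrow> real \<Rightarrow> (real \<Rightarrow> real) \<Rightarrow> real \<Rightarrow> real" where
  "q_durrmeyer n q \<alpha> \<beta> f x =
     (\<Sum>k=0..n. q_durrmeyer_coeff n k q \<alpha> \<beta> f * q_bernstein n k q x)"

lemma q_pow_of_nat: "q_pow q (real m) x = (\<Prod>j<m. 1 - q ^ j * x)"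
  by (simp add: q_pow_def)

lemma q_pow_eq_prodinf:
  assumes q: "0 < q" "q < 1"
    and nz: "\<And>j. 1 - q powr (real j + a) * x \<noteq> 0"
  shows "q_pow q a x = (\<Prod>j. (1 - q ^ j * x) / (1 - q powr (real j + a) * x))"
proof (cases "a \<in> \<nat>")
  case False
  then show ?thesis by (simp add: q_pow_def)
next
  case True
  then obtain m where a: "a = real m" by (auto elim: Nats_cases)
  define P where "P n = (\<Prod>j<n. 1 - q ^ j * x)" for n
  define g where "g j = (1 - q ^ j * x) / (1 - q ^ (j + m) * x)" for j
  define R where "R n = (\<Prod>j<m. 1 - q ^ (n + j) * x)" for n
  have pw: "q powr (real j + a) = q ^ (j + m)" for j
    using q by (simp add: a powr_realpow flip: of_nat_add)
  have nz': "1 - q ^ (j + m) * x \<noteq> 0" for j using nz[of j] by (simp add: pw)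
  have lim0: "(\<lambda>n. q ^ n) \<longlonglongrightarrow> 0" using q by (intro LIMSEQ_realpow_zero) auto
  have limD: "(\<lambda>n. 1 - q ^ (n + c) * x) \<longlonglongrightarrow> 1" for c
  proof -
    have "(\<lambda>n. 1 - (q ^ n * q ^ c) * x) \<longlonglongrightarrow> 1 - (0 * q ^ c) * x"
      by (intro tendsto_intros lim0)
    then show ?thesis by (simp add: power_add)
  qed
  have ev: "\<forall>\<^sub>F n in sequentially. 1 - q ^ (n + m) * x > 1 / 2"
    by (rule order_tendstoD(1)[OF limD]) simp
  have "summable (\<lambda>n. norm (g n - 1))"
  proof (rule summable_comparison_test_ev)
    show "summable (\<lambda>n. 2 * (\<bar>x\<bar> * \<bar>q ^ m - 1\<bar>) * q ^ n)"
      using q by (intro summable_mult summable_geometric) auto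
    show "\<forall>\<^sub>F n in sequentially. norm (norm (g n - 1)) \<le> 2 * (\<bar>x\<bar> * \<bar>q ^ m - 1\<bar>) * q ^ n"
      using ev
    proof eventually_elim
      case (elim n)
      have "g n - 1 = q ^ n * (x * (q ^ m - 1)) / (1 - q ^ (n + m) * x)"
        using nz'[of n] by (simp add: g_def field_simps power_add)
      then have "norm (norm (g n - 1)) = q ^ n * (\<bar>x\<bar> * \<bar>q ^ m - 1\<bar>) / (1 - q ^ (n + m) * x)"
        using elim q by (simp add: abs_mult)
      also have "\<dots> \<le> q ^ n * (\<bar>x\<bar> * \<bar>q ^ m - 1\<bar>) / (1 / 2)"
        using elim q by (intro divide_left_mono) auto
      finally show ?case by (simp add: mult_ac)
    qed
  qed
  then have conv: "convergent_prod g"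
    by (intro abs_convergent_prod_imp_convergent_prod) (simp add: abs_convergent_prod_conv_summable)
  have lim1: "(\<lambda>n. \<Prod>i\<le>n. g i) \<longlonglongrightarrow> prodinf g"
    by (rule convergent_prod_LIMSEQ[OF conv])
  have lim1': "(\<lambda>n. \<Prod>i<n. g i) \<longlonglongrightarrow> prodinf g"
    by (rule LIMSEQ_imp_Suc) (use lim1 in \<open>simp add: lessThan_Suc_atMost\<close>)
  have "R \<longlonglongrightarrow> (\<Prod>j<m. 1)"
    unfolding R_def by (intro tendsto_prod limD)
  then have lim2: "(\<lambda>n. (\<Prod>i<n. g i) * R n) \<longlonglongrightarrow> prodinf g"
    using tendsto_mult[OF lim1'] by fastforce
  have split: "P (c + d) = P c * (\<Prod>j<d. 1 - q ^ (c + j) * x)" for c d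
    by (induction d) (simp_all add: P_def mult.assoc)
  have "(\<Prod>i<n. g i) * R n = P m" for n
  proof -
    have D: "(\<Prod>i<n. 1 - q ^ (i + m) * x) \<noteq> 0" using nz' by simp
    have "P n * R n = P m * (\<Prod>i<n. 1 - q ^ (i + m) * x)"
      using split[of n m] split[of m n] by (simp add: R_def add.commute)
    moreover have "(\<Prod>i<n. g i) = P n / (\<Prod>i<n. 1 - q ^ (i + m) * x)"
      by (simp add: g_def P_def prod_dividef)
    ultimately have "((\<Prod>i<n. g i) * R n) * (\<Prod>i<n. 1 - q ^ (i + m) * x)
        = P m * (\<Prod>i<n. 1 - q ^ (i + m) * x)"
      using D by simp
    then show ?thesis using D by (metis mult_right_cancel)
  qed
  then have "prodinf g = P m"
    using lim2 LIMSEQ_unique[OF tendsto_const] by force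
  then show ?thesis
    unfolding pw by (simp add: a q_pow_of_nat P_def g_def[abs_def])
qed

lemma q_durrmeyer_has_deriv:
  "(q_durrmeyer n q \<alpha> \<beta> f has_real_derivative deriv (q_durrmeyer n q \<alpha> \<beta> f) x) (at x)"
proof -
  have [derivative_intros]: "(\<lambda>z. \<Prod>j<m. 1 - q ^ j * z) field_differentiable at x" for m
    by (induction m) (auto intro!: derivative_intros)
  have "q_durrmeyer n q \<alpha> \<beta> f field_differentiable at x"
    unfolding q_durrmeyer_def[abs_def] q_bernstein_def q_pow_of_nat
    by (intro derivative_intros field_differentiable_sum)
  then show ?thesis by (simp add: DERIV_deriv_iff_field_differentiable)
qed

end

theory Submission imports Defs begin

text \<open>
  Write \<open>c\<^sub>k\<close> for the coefficient of the basis polynomial with index \<open>k\<close> in \<open>M f\<close> for the degree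
  \<open>n + 1\<close>. The theorem rests on three facts.

  First, the \<open>q\<close>-Bernstein basis may be replaced by the classical one. Both come from the same
  de Casteljau-type recursion, in which each step moves from \<open>c k\<close> towards \<open>c (k + 1)\<close> by the
  fraction \<open>r n k * x\<close>; here \<open>r n k = q ^ (n - k)\<close> for the \<open>q\<close>-basis and \<open>r n k = 1\<close> for the
  classical one. Since \<open>1 - q ^ (n - k) \<le> n * (1 - q)\<close>, an induction on \<open>n\<close>
  (\<open>casteljau_perturbation\<close>) shows that the derivatives of the two polynomials with the same bounded
  coefficients differ by \<open>O(n\<^sup>3 * (1 - q))\<close>, which tends to \<open>0\<close>. The derivative of the
  classical polynomial of degree \<open>n + 1\<close> is the Bernstein polynomial of degree \<open>n\<close> with the
  coefficients \<open>(n + 1) * (c\<^sub>k\<^sub>+\<^sub>1 - c\<^sub>k)\<close>, called \<open>coeff_slope\<close> below.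

  Second, these slopes approach \<open>f' (k / n)\<close>, uniformly in \<open>k\<close>. The coefficient \<open>c\<^sub>k\<close> is the mean of
  \<open>f (q powr (\<beta> + 1) * t)\<close> under a discrete \<open>q\<close>-beta distribution on the points \<open>t = q ^ i\<close>. The
  likelihood ratio of the distributions with indices \<open>k + 1\<close> and \<open>k\<close> is increasing in \<open>t\<close>, so
  the slope is a monotone functional: it is nonnegative on nondecreasing functions
  (\<open>qbeta_mean_mono\<close>). With \<open>y = k / n\<close>, uniform continuity gives
  \<open>\<bar>f' t - f' y\<bar> \<le> \<epsilon> + C * (t - y)\<^sup>2\<close>; hence \<open>\<epsilon> * t + C / 3 * (t - y) ^ 3\<close> plus or minus
  \<open>f t - f' y * t\<close> is nondecreasing. Monotonicity then bounds the slope of \<open>f t - f' y * t\<close> by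
  that of a cubic polynomial (\<open>coeff_slope_sandwich\<close>). The slopes of \<open>t\<close>, \<open>t\<^sup>2\<close> and \<open>t\<^sup>3\<close> are
  explicit ratios of \<open>q\<close>-numbers, asymptotic to \<open>1\<close>, \<open>2 * y\<close> and \<open>3 * y\<^sup>2\<close>, so that the slope of
  \<open>(t - y) ^ 3\<close> vanishes in the limit.

  Third, the Bernstein polynomials of the continuous function \<open>f'\<close> converge to it uniformly.
\<close>

section \<open>Perturbed Bernstein polynomials\<close>

text \<open>
  With \<open>r n k = 1\<close> this is the evaluation of a polynomial in Bernstein form by de Casteljau's
  algorithm. For weights between \<open>0\<close> and \<open>1\<close> and \<open>x\<close> in the unit interval every step forms convex
  combinations of neighbouring coefficients, which is where all the bounds come from.
\<close>
primrec casteljau :: "(nat \<Rightarrow> nat \<Rightarrow> real) \<Rightarrow> nat \<Rightarrow> (nat \<Rightarrow> real) \<Rightarrow> real \<Rightarrow> real" where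
  "casteljau r 0 c x = c 0"
| "casteljau r (Suc n) c x = casteljau r n (\<lambda>k. c k + x * (r n k * (c (Suc k) - c k))) x"

text \<open>
  The derivative of \<open>casteljau r n c\<close> at \<open>x\<close>. By linearity in the coefficients the product rule splits a
  step into two parts: the first summand holds the \<open>x\<close> in the new coefficients fixed, the second
  differentiates those coefficients.
\<close>
primrec casteljau' :: "(nat \<Rightarrow> nat \<Rightarrow> real) \<Rightarrow> nat \<Rightarrow> (nat \<Rightarrow> real) \<Rightarrow> real \<Rightarrow> real" where
  "casteljau' r 0 c x = 0"
| "casteljau' r (Suc n) c x =
     casteljau' r n (\<lambda>k. c k + x * (r n k * (c (Suc k) - c k))) x
     + casteljau r n (\<lambda>k. r n k * (c (Suc k) - c k)) x"

lemma casteljau_lincomb: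
  "casteljau r n (\<lambda>k. c k + a * d k) x = casteljau r n c x + a * casteljau r n d x"
proof (induction n arbitrary: c d)
  case (Suc n)
  have "(\<lambda>k. c k + a * d k + x * (r n k * (c (Suc k) + a * d (Suc k) - (c k + a * d k))))
     = (\<lambda>k. (c k + x * (r n k * (c (Suc k) - c k))) + a * (d k + x * (r n k * (d (Suc k) - d k))))"
    by (auto simp: algebra_simps)
  then show ?case by (simp add: Suc)
qed simp

lemma casteljau'_lincomb:
  "casteljau' r n (\<lambda>k. c k + a * d k) x = casteljau' r n c x + a * casteljau' r n d x"
proof (induction n arbitrary: c d)
  case (Suc n)
  have "(\<lambda>k. c k + a * d k + x * (r n k * (c (Suc k) + a * d (Suc k) - (c k + a * d k))))
     = (\<lambda>k. (c k + x * (r n k * (c (Suc k) - c k))) + a * (d k + x * (r n k * (d (Suc k) - d k))))"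
    by (auto simp: algebra_simps)
  moreover have "(\<lambda>k. r n k * (c (Suc k) + a * d (Suc k) - (c k + a * d k)))
     = (\<lambda>k. r n k * (c (Suc k) - c k) + a * (r n k * (d (Suc k) - d k)))"
    by (auto simp: algebra_simps)
  ultimately show ?case
    unfolding casteljau'.simps by (simp only: Suc casteljau_lincomb) (simp add: distrib_left)
qed simp

lemma casteljau_has_real_derivative:
  "((\<lambda>x. casteljau r n c x) has_real_derivative casteljau' r n c x) (at x)"
proof (induction n arbitrary: c)
  case (Suc n)
  show ?case
    unfolding casteljau.simps casteljau'.simps casteljau_lincomb casteljau'_lincomb
    by (rule derivative_eq_intros Suc refl)+ simp
qed (simp add: casteljau.simps(1)[abs_def])

lemma casteljau_step_bound:
  fixes s u v B :: real
  assumes "0 \<le> s" "s \<le> 1" "\<bar>u\<bar> \<le> B" "\<bar>v\<bar> \<le> B"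
  shows "\<bar>u + s * (v - u)\<bar> \<le> B"
proof -
  have "\<bar>u + s * (v - u)\<bar> = \<bar>(1 - s) * u + s * v\<bar>" by (simp add: algebra_simps)
  also have "\<dots> \<le> (1 - s) * \<bar>u\<bar> + s * \<bar>v\<bar>"
    using assms by (metis abs_mult abs_of_nonneg abs_triangle_ineq diff_ge_0_iff_ge)
  also have "\<dots> \<le> (1 - s) * B + s * B"
    using assms by (intro add_mono mult_left_mono) auto
  finally show ?thesis by (simp add: algebra_simps)
qed

context
  fixes r :: "nat \<Rightarrow> nat \<Rightarrow> real" and x :: real
  assumes r: "\<And>n k. k \<le> n \<Longrightarrow> 0 \<le> r n k \<and> r n k \<le> 1" and x: "0 \<le> x" "x \<le> 1"
begin

lemma casteljau_coeff_bound:
  assumes "\<And>k. k \<le> Suc n \<Longrightarrow> \<bar>c k\<bar> \<le> B" "k \<le> n"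
  shows "\<bar>c k + x * (r n k * (c (Suc k) - c k))\<bar> \<le> B"
  using casteljau_step_bound[of "x * r n k" "c k" B "c (Suc k)"] assms r[of k n] x
  by (simp add: mult.assoc mult_le_one)

lemma casteljau_diff_bound:
  assumes "\<And>k. k \<le> Suc n \<Longrightarrow> \<bar>c k\<bar> \<le> B" "k \<le> n"
  shows "\<bar>r n k * (c (Suc k) - c k)\<bar> \<le> 2 * B"
proof -
  have "\<bar>r n k * (c (Suc k) - c k)\<bar> = r n k * \<bar>c (Suc k) - c k\<bar>"
    using r[OF assms(2)] by (simp add: abs_mult)
  also have "\<dots> \<le> 1 * \<bar>c (Suc k) - c k\<bar>"
    using r[OF assms(2)] by (intro mult_right_mono) auto
  also have "\<dots> \<le> 2 * B" using assms(1)[of k] assms(1)[of "Suc k"] assms(2) by auto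
  finally show ?thesis .
qed

lemma casteljau_bound:
  assumes "\<And>k. k \<le> n \<Longrightarrow> \<bar>c k\<bar> \<le> B"
  shows "\<bar>casteljau r n c x\<bar> \<le> B"
  using assms
proof (induction n arbitrary: c)
  case (Suc n)
  show ?case
    unfolding casteljau.simps
    by (rule Suc.IH) (rule casteljau_coeff_bound, use Suc.prems in auto)
qed simp

text \<open>
  Each of the \<open>n\<close> steps contributes one value at a vector of differences, and these are at most
  \<open>2 * B\<close>.
\<close>
lemma casteljau'_bound:
  assumes "\<And>k. k \<le> n \<Longrightarrow> \<bar>c k\<bar> \<le> B"
  shows "\<bar>casteljau' r n c x\<bar> \<le> 2 * B * real n"
  using assms
proof (induction n arbitrary: c)
  case (Suc n)
  have "\<bar>casteljau' r n (\<lambda>k. c k + x * (r n k * (c (Suc k) - c k))) x\<bar> \<le> 2 * B * real n"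
    by (rule Suc.IH) (rule casteljau_coeff_bound, use Suc.prems in auto)
  moreover have "\<bar>casteljau r n (\<lambda>k. r n k * (c (Suc k) - c k)) x\<bar> \<le> 2 * B"
    by (rule casteljau_bound) (rule casteljau_diff_bound, use Suc.prems in auto)
  ultimately show ?case by (simp add: algebra_simps)
qed simp

end

text \<open>
  Replacing the weight \<open>r n k\<close> by \<open>1\<close> in one step changes the coefficients by at most
  \<open>2 * B * \<eta> * n\<close>. Such errors add up over the steps in the values; in the derivatives
  each of them is amplified by the factor \<open>2 * n\<close> of \<open>casteljau'_bound\<close>.
  Both estimates are proved in one induction because the one for derivatives uses the one for values.
\<close>
lemma casteljau_perturbation:
  fixes r :: "nat \<Rightarrow> nat \<Rightarrow> real" and x \<eta> :: real
  assumes r: "\<And>n k. k \<le> n \<Longrightarrow> 0 \<le> r n k \<and> r n k \<le> 1"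
    and near: "\<And>n k. k \<le> n \<Longrightarrow> 1 - r n k \<le> real n * \<eta>"
    and x: "0 \<le> x" "x \<le> 1"
    and c: "\<And>k. k \<le> n \<Longrightarrow> \<bar>c k\<bar> \<le> B"
  shows "\<bar>casteljau r n c x - casteljau (\<lambda>_ _. 1) n c x\<bar> \<le> B * \<eta> * real n ^ 2 \<and>
    \<bar>casteljau' r n c x - casteljau' (\<lambda>_ _. 1) n c x\<bar> \<le> 2 * B * \<eta> * real n ^ 3"
  using c
proof (induction n arbitrary: c B)
  case (Suc n)
  let ?one = "\<lambda>_ _. 1 :: real"
  define d where "d k = c k + x * (c (Suc k) - c k)" for k
  define \<Delta> where "\<Delta> k = c (Suc k) - c k" for k
  define h where "h k = (1 - r n k) * \<Delta> k" for k
  have B: "0 \<le> B" using Suc.prems[of 0] by auto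
  have \<eta>: "0 \<le> \<eta>" using near[of 0 1] r[of 0 1] by simp
  have d: "\<bar>d k\<bar> \<le> B" if "k \<le> n" for k
    unfolding d_def using Suc.prems[of k] Suc.prems[of "Suc k"] that x
    by (intro casteljau_step_bound) auto
  have \<Delta>: "\<bar>\<Delta> k\<bar> \<le> 2 * B" if "k \<le> n" for k
    unfolding \<Delta>_def using Suc.prems[of k] Suc.prems[of "Suc k"] that by auto
  have h: "\<bar>h k\<bar> \<le> 2 * B * \<eta> * real n" if "k \<le> n" for k
  proof -
    have "\<bar>h k\<bar> = (1 - r n k) * \<bar>\<Delta> k\<bar>"
      using r[OF that] by (simp add: h_def abs_mult)
    also have "\<dots> \<le> (real n * \<eta>) * (2 * B)"
      using r[OF that] near[OF that] \<Delta>[OF that] \<eta> by (intro mult_mono) auto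
    finally show ?thesis by (simp add: mult_ac)
  qed
  have split1: "(\<lambda>k. c k + x * (r n k * (c (Suc k) - c k))) = (\<lambda>k. d k + (-x) * h k)"
    and split2: "(\<lambda>k. r n k * (c (Suc k) - c k)) = (\<lambda>k. \<Delta> k + (-1) * h k)"
    by (auto simp: d_def h_def \<Delta>_def algebra_simps)
  have dn: "(\<lambda>k. c k + x * (1 * (c (Suc k) - c k))) = d"
    and \<Delta>n: "(\<lambda>k. 1 * (c (Suc k) - c k)) = \<Delta>"
    by (auto simp: d_def \<Delta>_def)
  have xh: "\<bar>x * u\<bar> \<le> v" if "\<bar>u\<bar> \<le> v" for u v :: real
    using that x by (metis abs_ge_zero abs_mult abs_of_nonneg mult_left_le_one_le order_trans)
  have h1: "\<bar>casteljau r n h x\<bar> \<le> 2 * B * \<eta> * real n"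
    by (rule casteljau_bound[OF r x h])
  have h2: "\<bar>casteljau' r n h x\<bar> \<le> 2 * (2 * B * \<eta> * real n) * real n"
    by (rule casteljau'_bound[OF r x h])
  have d1: "\<bar>casteljau r n d x - casteljau ?one n d x\<bar> \<le> B * \<eta> * real n ^ 2"
    and d2: "\<bar>casteljau' r n d x - casteljau' ?one n d x\<bar> \<le> 2 * B * \<eta> * real n ^ 3"
    and \<Delta>1: "\<bar>casteljau r n \<Delta> x - casteljau ?one n \<Delta> x\<bar> \<le> (2 * B) * \<eta> * real n ^ 2"
    using Suc.IH[of d B, OF d] Suc.IH[of \<Delta> "2 * B", OF \<Delta>] by blast+
  have nn: "0 \<le> B * \<eta>" using B \<eta> by simp
  have e1: "casteljau r (Suc n) c x - casteljau ?one (Suc n) c x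
     = (casteljau r n d x - casteljau ?one n d x) - x * casteljau r n h x"
    unfolding casteljau.simps split1 dn unfolding casteljau_lincomb by simp
  have "\<bar>casteljau r (Suc n) c x - casteljau ?one (Suc n) c x\<bar>
     \<le> B * \<eta> * real n ^ 2 + 2 * B * \<eta> * real n"
    unfolding e1 using d1 xh[OF h1] by linarith
  also have "\<dots> = B * \<eta> * (real n ^ 2 + 2 * real n)" by (simp add: algebra_simps)
  also have "\<dots> \<le> B * \<eta> * real (Suc n) ^ 2"
    using nn by (intro mult_left_mono) (auto simp: power2_eq_square algebra_simps)
  finally have 1: "\<bar>casteljau r (Suc n) c x - casteljau ?one (Suc n) c x\<bar>
     \<le> B * \<eta> * real (Suc n) ^ 2" .
  have e2: "casteljau' r (Suc n) c x - casteljau' ?one (Suc n) c x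
     = (casteljau' r n d x - casteljau' ?one n d x) - x * casteljau' r n h x
       + ((casteljau r n \<Delta> x - casteljau ?one n \<Delta> x) - casteljau r n h x)"
    unfolding casteljau'.simps split1 split2 dn \<Delta>n
    unfolding casteljau_lincomb casteljau'_lincomb by simp
  have "\<bar>casteljau' r (Suc n) c x - casteljau' ?one (Suc n) c x\<bar>
     \<le> 2 * B * \<eta> * real n ^ 3 + 2 * (2 * B * \<eta> * real n) * real n
        + ((2 * B) * \<eta> * real n ^ 2 + 2 * B * \<eta> * real n)"
    unfolding e2 using d2 xh[OF h2] \<Delta>1 h1 by linarith
  also have "\<dots> = 2 * B * \<eta> * (real n ^ 3 + 3 * real n ^ 2 + real n)"
    by (simp add: algebra_simps power2_eq_square)
  also have "\<dots> \<le> 2 * B * \<eta> * real (Suc n) ^ 3"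
    using nn by (intro mult_left_mono) (auto simp: power2_eq_square power3_eq_cube algebra_simps)
  finally show ?case using 1 by blast
qed auto

lemma casteljau'_one_Suc:
  "casteljau' (\<lambda>_ _. 1) (Suc n) c x
     = real (Suc n) * casteljau (\<lambda>_ _. 1) n (\<lambda>k. c (Suc k) - c k) x"
proof (induction n arbitrary: c)
  case (Suc n)
  have *: "(\<lambda>k. c (Suc k) + x * (c (Suc (Suc k)) - c (Suc k)) - (c k + x * (c (Suc k) - c k)))
    = (\<lambda>k. (c (Suc k) - c k) + x * (c (Suc (Suc k)) - c (Suc k) - (c (Suc k) - c k)))"
    by (auto simp: algebra_simps)
  show ?case
    by (subst casteljau'.simps, subst Suc.IH) (simp add: * algebra_simps)
qed simp

text \<open>
  A basis with a two-term Pascal recursion evaluates to the algorithm: collecting the factor of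
  \<open>b n k\<close> in the sum of degree \<open>n + 1\<close> leaves the new coefficients of the algorithm.
\<close>
lemma casteljau_eq_sum:
  fixes b :: "nat \<Rightarrow> nat \<Rightarrow> real"
  assumes b00: "b 0 0 = 1" and b0: "\<And>n. b (Suc n) 0 = (1 - x * r n 0) * b n 0"
    and b: "\<And>n k. k \<le> n \<Longrightarrow> b (Suc n) (Suc k) = x * r n k * b n k 
        + (if k < n then (1 - x * r n (Suc k)) * b n (Suc k) else 0)"
  shows "casteljau r n c x = (\<Sum>k\<le>n. c k * b n k)"
proof (induction n arbitrary: c)
  case (Suc n)
  have "(\<Sum>k\<le>Suc n. c k * b (Suc n) k) = c 0 * b (Suc n) 0 + (\<Sum>k\<le>n. c (Suc k) * b (Suc n) (Suc k))"
    by (rule sum.atMost_Suc_shift)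
  also have "(\<Sum>k\<le>n. c (Suc k) * b (Suc n) (Suc k))
     = (\<Sum>k\<le>n. c (Suc k) * (x * r n k * b n k)) 
     + (\<Sum>k\<le>n. c (Suc k) * (if k < n then (1 - x * r n (Suc k)) * b n (Suc k) else 0))"
    unfolding sum.distrib[symmetric] by (rule sum.cong) (auto simp: b distrib_left)
  also have "(\<Sum>k\<le>n. c (Suc k) * (if k < n then (1 - x * r n (Suc k)) * b n (Suc k) else 0))
     = (\<Sum>k<n. c (Suc k) * ((1 - x * r n (Suc k)) * b n (Suc k)))"
    by (intro sum.mono_neutral_cong_right) auto
  also have "c 0 * b (Suc n) 0 + ((\<Sum>k\<le>n. c (Suc k) * (x * r n k * b n k)) + \<dots>)
     = (\<Sum>k\<le>n. c (Suc k) * (x * r n k * b n k)) + (\<Sum>k<Suc n. c k * ((1 - x * r n k) * b n k))"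
    by (subst sum.lessThan_Suc_shift) (simp add: b0)
  also have "\<dots> = (\<Sum>k\<le>n. (c k + x * (r n k * (c (Suc k) - c k))) * b n k)"
    unfolding lessThan_Suc_atMost sum.distrib[symmetric] by (rule sum.cong) (auto simp: algebra_simps)
  finally show ?case by (simp add: Suc.IH)
qed (simp add: b00)

lemma casteljau_one_eq_Bernstein:
  "casteljau (\<lambda>_ _. 1) n c x = (\<Sum>k\<le>n. c k * Bernstein n k x)"
proof (rule casteljau_eq_sum)
  fix n k :: nat
  assume "k \<le> n"
  then show "Bernstein (Suc n) (Suc k) x = x * 1 * Bernstein n k x +
     (if k < n then (1 - x * 1) * Bernstein n (Suc k) x else 0)"
    by (cases "k < n")
      (auto simp: Bernstein_def algebra_simps dest!: less_imp_Suc_add)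
qed (auto simp: Bernstein_def)

lemma q_num_pos: "0 < q \<Longrightarrow> q < 1 \<Longrightarrow> 0 < a \<Longrightarrow> 0 < q_num q a"
  by (simp add: q_num_def powr01_less_one)

lemma q_fact_Suc: "q_fact q (Suc n) = q_fact q n * q_num q (real (Suc n))"
  by (simp add: q_fact_def)

lemma q_num_nat_add: "0 < q \<Longrightarrow> q < 1 \<Longrightarrow>
   q_num q (real (m + k)) = q ^ m * q_num q (real k) + q_num q (real m)"
  by (simp only: q_num_def) (simp add: powr_add powr_realpow field_simps)

lemma q_fact_pos: "0 < q \<Longrightarrow> q < 1 \<Longrightarrow> 0 < q_fact q n"
  unfolding q_fact_def by (intro prod_pos) (auto intro: q_num_pos)

text \<open>
  Of the two \<open>q\<close>-Pascal rules, this is the one whose weights make the step of the \<open>q\<close>-Bernstein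
  basis stochastic: \<open>q ^ (n - k) * x\<close> and \<open>1 - q ^ (n - k) * x\<close> add up to \<open>1\<close>.
\<close>
lemma q_binomial_Suc_Suc:
  assumes q: "0 < q" "q < 1" and k: "k < n"
  shows "q_binomial q (Suc n) (Suc k) = q ^ (n - k) * q_binomial q n k + q_binomial q n (Suc k)"
proof -
  obtain m where n: "n = Suc (m + k)" using k less_imp_Suc_add by (metis add.commute)
  have nz: "q_fact q i \<noteq> 0" "q_num q (1 + real i) \<noteq> 0" for i
    using q_fact_pos[OF q, of i] q_num_pos[OF q, of "1 + real i"] by auto
  have "q_num q (real (Suc n)) = q ^ Suc m * q_num q (real (Suc k)) + q_num q (real (Suc m))"
    using q_num_nat_add[OF q, of "Suc m" "Suc k"] n by simp
  then show ?thesis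
    using nz unfolding q_binomial_def n
    by (simp add: q_fact_Suc Suc_diff_le divide_simps) (simp add: algebra_simps)
qed

lemma q_bernstein_eq_casteljau:
  assumes q: "0 < q" "q < 1"
  shows "(\<Sum>k\<le>n. c k * q_bernstein n k q x) = casteljau (\<lambda>n k. q ^ (n - k)) n c x"
proof (rule casteljau_eq_sum[symmetric])
  have nz: "q_fact q i \<noteq> 0" for i using q_fact_pos[OF q, of i] by simp
  have bin: "q_binomial q i 0 = 1" "q_binomial q i i = 1" for i
    using nz[of i] by (simp_all add: q_binomial_def q_fact_def[of _ 0])
  show "q_bernstein 0 0 q x = 1"
    unfolding q_bernstein_def q_pow_of_nat by (simp add: bin)
  show "q_bernstein (Suc n) 0 q x = (1 - x * q ^ (n - 0)) * q_bernstein n 0 q x" for n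
    unfolding q_bernstein_def q_pow_of_nat by (simp add: bin mult.commute)
  fix n k :: nat assume k: "k \<le> n"
  show "q_bernstein (Suc n) (Suc k) q x = x * q ^ (n - k) * q_bernstein n k q x +
     (if k < n then (1 - x * q ^ (n - Suc k)) * q_bernstein n (Suc k) q x else 0)"
  proof (cases "k < n")
    case True
    then obtain m where n: "n = Suc (m + k)" using less_imp_Suc_add by (metis add.commute)
    show ?thesis
      using True unfolding q_bernstein_def q_pow_of_nat q_binomial_Suc_Suc[OF q True]
      by (simp add: n Suc_diff_le algebra_simps)
  next
    case False
    with k show ?thesis
      unfolding q_bernstein_def q_pow_of_nat by (simp add: bin)
  qed
qed

section \<open>Discrete q-beta distributions\<close>

text \<open>
  Passing from \<open>x\<close> to \<open>q * x\<close> shifts the index of the infinite product by one, so only its first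
  factor changes. The bound \<open>x \<le> q\<close> keeps all denominators positive for exponents above \<open>-1\<close>.
\<close>
lemma q_pow_shift:
  assumes q: "0 < q" "q < 1" and b: "b > -1" and x: "0 < x" "x \<le> q"
  shows q_pow_pos: "0 < q_pow q b x"
    and q_pow_scale: "q_pow q b (q * x) * (1 - x) = q_pow q b x * (1 - q powr b * x)"
proof -
  define g where "g y j = (1 - q ^ j * y) / (1 - q powr (real j + b) * y)" for y j
  have small: "q ^ j * y < 1" "q powr (real j + b) * y < 1" if "0 < y" "y \<le> q" for j y
  proof -
    have "q ^ j * y \<le> 1 * q"
      using q that by (intro mult_mono power_le_one) auto
    then show "q ^ j * y < 1" using q by simp
    have "q powr (real j + b) * y \<le> q powr (real j + b) * q powr 1"
      using q that by (intro mult_left_mono) auto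
    also have "\<dots> = q powr (real j + b + 1)" by (simp add: powr_add)
    also have "\<dots> < 1" using q b by (simp add: powr01_less_one)
    finally show "q powr (real j + b) * y < 1" .
  qed
  have qx: "0 < q * x" "q * x \<le> q" using q x by (auto intro: mult_left_le)
  have eq: "q_pow q b y = prodinf (g y)" if "0 < y" "y \<le> q" for y
    unfolding g_def using small(2)[OF that] q by (intro q_pow_eq_prodinf) (auto simp: less_le)
  have pos: "0 < g y j" if "0 < y" "y \<le> q" for y j
    unfolding g_def using small[OF that] by simp
  have "summable (\<lambda>n. norm (g x n - 1))"
  proof (rule summable_comparison_test')
    show "summable (\<lambda>n. \<bar>q powr b - 1\<bar> * x / (1 - q powr b * x) * q ^ n)"
      using q by (intro summable_mult summable_geometric) auto
    fix n :: nat
    have p: "q powr (real n + b) = q ^ n * q powr b" using q by (simp add: powr_add powr_realpow)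
    have "q powr b * x < 1" using small(2)[OF x, of 0] by simp
    moreover have le: "q powr (real n + b) * x \<le> q powr b * x"
      using q x by (intro mult_right_mono powr_mono') auto
    moreover have "g x n - 1 = q ^ n * ((q powr b - 1) * x) / (1 - q powr (real n + b) * x)"
        and "0 < 1 - q powr (real n + b) * x"
      using small(2)[OF x, of n] unfolding g_def p
      by (simp_all add: divide_simps) (simp add: algebra_simps)
    ultimately have "norm (norm (g x n - 1)) = q ^ n * (\<bar>q powr b - 1\<bar> * x) / (1 - q powr (real n + b) * x)"
      using q x by (simp add: abs_mult abs_of_pos)
    also have "\<dots> \<le> q ^ n * (\<bar>q powr b - 1\<bar> * x) / (1 - q powr b * x)"
      using le \<open>q powr b * x < 1\<close> q x
      by (intro divide_left_mono mult_pos_pos mult_nonneg_nonneg) (linarith | simp)+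
    finally show "norm (norm (g x n - 1)) \<le> \<bar>q powr b - 1\<bar> * x / (1 - q powr b * x) * q ^ n"
      by (simp add: mult_ac)
  qed
  then have conv: "convergent_prod (g x)"
    by (intro abs_convergent_prod_imp_convergent_prod) (simp add: abs_convergent_prod_conv_summable)
  show "0 < q_pow q b x"
    unfolding eq[OF x] by (rule less_0_prodinf[OF conv pos[OF x]])
  have "g (q * x) = (\<lambda>j. g x (Suc j))"
    using q by (auto simp: g_def powr_add mult_ac)
  then have "prodinf (g (q * x)) = prodinf (g x) / g x 0"
    using prodinf_split_head[OF conv] pos[OF x, of 0] by (simp add: less_le)
  then show "q_pow q b (q * x) * (1 - x) = q_pow q b x * (1 - q powr b * x)"
    unfolding eq[OF x] eq[OF qx] using small[OF x, of 0] by (simp add: g_def field_simps)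
qed

text \<open>
  The summand of the Jackson integral of \<open>t powr (A - 1) * (1 - q * t)\<^sub>q\<^sup>b\<close> at \<open>t = q ^ i\<close>, up to the
  constant \<open>1 - q\<close>; the factor \<open>q ^ i\<close> of the integral is absorbed into the power.
\<close>
definition qbeta_weight :: "real \<Rightarrow> real \<Rightarrow> real \<Rightarrow> nat \<Rightarrow> real" where
  "qbeta_weight q A b i = (q powr A) ^ i * q_pow q b (q ^ Suc i)"

definition qbeta_mean :: "real \<Rightarrow> real \<Rightarrow> real \<Rightarrow> (real \<Rightarrow> real) \<Rightarrow> real" where
  "qbeta_mean q A b g =
     (\<Sum>i. qbeta_weight q A b i * g (q ^ i)) / (\<Sum>i. qbeta_weight q A b i)"

lemma q_durrmeyer_coeff_eq_qbeta_mean: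
  assumes q: "0 < q" "q < 1"
  shows "q_durrmeyer_coeff n k q \<alpha> \<beta> f
     = qbeta_mean q (real k + \<alpha> + 1) (real (n - k) + \<beta>) (\<lambda>t. f (q powr (\<beta> + 1) * t))"
proof -
  have p: "q ^ i * (q ^ i) powr (real k + \<alpha>) = (q powr (real k + \<alpha> + 1)) ^ i" for i
  proof -
    have "q ^ i * (q ^ i) powr (real k + \<alpha>) = q powr real i * q powr (real i * (real k + \<alpha>))"
      using q by (simp add: powr_powr flip: powr_realpow)
    also have "\<dots> = q powr (real i * (real k + \<alpha> + 1))"
      by (simp add: algebra_simps flip: powr_add)
    also have "\<dots> = (q powr (real k + \<alpha> + 1)) powr real i"
      by (simp add: powr_powr mult.commute)
    finally show ?thesis using q by (simp add: powr_realpow)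
  qed
  show ?thesis
    using q unfolding q_durrmeyer_coeff_def jackson_integral_def qbeta_mean_def qbeta_weight_def
    by (simp add: p[symmetric] mult.assoc)
qed

context
  fixes q :: real assumes q: "0 < q" "q < 1"
begin

lemma qbeta_weight_pos: "b > -1 \<Longrightarrow> 0 < qbeta_weight q A b i"
  using q unfolding qbeta_weight_def
  by (intro mult_pos_pos q_pow_pos) (auto intro!: mult_left_le power_le_one)

text \<open>
  This recursion determines the weights up to normalisation; summability, the moments and the
  monotone likelihood ratio all follow from it.
\<close>
lemma qbeta_weight_Suc:
  assumes "b > -1"
  shows "qbeta_weight q A b (Suc i) * (1 - q ^ Suc i)
           = q powr A * qbeta_weight q A b i * (1 - q powr (b + 1) * q ^ i)"
  using q_pow_scale[OF q assms, of "q ^ Suc i"] q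
  by (simp add: qbeta_weight_def power_le_one mult_left_le powr_add mult_ac)

lemma qbeta_weight_summable:
  assumes "A > 0" "b > -1"
  shows "summable (qbeta_weight q A b)"
proof -
  let ?w = "qbeta_weight q A b"
  define \<rho> where "\<rho> i = q powr A * (1 - q powr (b + 1) * q ^ i) / (1 - q ^ Suc i)" for i
  have "(\<lambda>i. q ^ Suc i) \<longlonglongrightarrow> 0" "(\<lambda>i. q ^ i) \<longlonglongrightarrow> 0"
    using q LIMSEQ_realpow_zero[of q] LIMSEQ_Suc[of "\<lambda>i. q ^ i" 0] by auto
  then have "\<rho> \<longlonglongrightarrow> q powr A * (1 - q powr (b + 1) * 0) / (1 - 0)"
    unfolding \<rho>_def by (intro tendsto_divide tendsto_mult tendsto_diff tendsto_const) (assumption | simp)+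
  moreover obtain c where c: "q powr A < c" "c < 1"
    using dense[of "q powr A" 1] q assms powr01_less_one by blast
  ultimately have "\<forall>\<^sub>F i in sequentially. \<rho> i < c"
    by (intro order_tendstoD) auto
  then obtain N where N: "\<And>i. i \<ge> N \<Longrightarrow> \<rho> i < c"
    unfolding eventually_sequentially by blast
  show ?thesis
  proof (rule summable_ratio_test[OF c(2), of N])
    fix i assume "i \<ge> N"
    have "q ^ Suc i < 1" using q by (simp add: power_less_one_iff del: power_Suc)
    then have "?w (Suc i) = \<rho> i * ?w i"
      using qbeta_weight_Suc[OF assms(2), of A i] by (simp add: \<rho>_def field_simps del: power_Suc)
    also have "\<dots> \<le> c * ?w i"
      using N[OF \<open>i \<ge> N\<close>] qbeta_weight_pos[OF assms(2)] by (intro mult_right_mono) (auto simp: less_imp_le)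
    finally show "norm (?w (Suc i)) \<le> c * norm (?w i)"
      using qbeta_weight_pos[OF assms(2), of A] by (simp add: less_imp_le)
  qed
qed

lemma qbeta_total_pos:
  assumes "A > 0" "b > -1"
  shows "0 < (\<Sum>i. qbeta_weight q A b i)"
  by (rule suminf_pos[OF qbeta_weight_summable[OF assms] qbeta_weight_pos[OF assms(2)]])

lemma qbeta_weight_A_Suc: "qbeta_weight q (A + 1) b i = qbeta_weight q A b i * q ^ i"
  using q by (simp add: qbeta_weight_def powr_add power_mult_distrib)

text \<open>
  Summing the recursion of the weights over all \<open>i\<close>, the term \<open>i = 0\<close> that is missing on the left
  vanishes, since \<open>1 - q ^ 0 = 0\<close>. What remains is a linear relation between the two totals: the
  functional equation of the \<open>q\<close>-beta function.
\<close>
lemma qbeta_total_shift: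
  assumes "A > 0" "b > -1"
  shows "(\<Sum>i. qbeta_weight q (A + 1) b i)
           = q_num q A / q_num q (A + b + 1) * (\<Sum>i. qbeta_weight q A b i)"
proof -
  let ?w = "qbeta_weight q A b" and ?w' = "qbeta_weight q (A + 1) b"
  have s: "summable ?w" "summable ?w'"
    using assms by (auto intro: qbeta_weight_summable)
  have d: "summable (\<lambda>i. ?w i - ?w' i)" by (rule summable_diff[OF s])
  have "suminf ?w - suminf ?w' = (\<Sum>i. ?w i - ?w' i)" by (rule suminf_diff[OF s])
  also have "\<dots> = (\<Sum>i. ?w (Suc i) - ?w' (Suc i))"
    using suminf_split_head[OF d] qbeta_weight_A_Suc[of A b 0] by simp
  also have "\<dots> = (\<Sum>i. q powr A * (?w i - q powr (b + 1) * ?w' i))"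
    using qbeta_weight_Suc[OF assms(2), of A]
    by (intro suminf_cong) (simp add: qbeta_weight_A_Suc algebra_simps)
  also have "\<dots> = q powr A * (suminf ?w - q powr (b + 1) * suminf ?w')"
    using suminf_diff[OF s(1) summable_mult[OF s(2)], of "q powr (b + 1)"]
    by (subst suminf_mult) (auto intro: summable_diff summable_mult s simp: suminf_mult s)
  finally have "suminf ?w' * (1 - q powr (A + b + 1)) = suminf ?w * (1 - q powr A)"
    by (simp add: algebra_simps powr_add)
  moreover have "q powr (A + b + 1) < 1" using assms q by (simp add: powr01_less_one)
  moreover have "q_num q A / q_num q (A + b + 1) = (1 - q powr A) / (1 - q powr (A + b + 1))"
    using q by (simp add: q_num_def)
  ultimately show ?thesis
    by (simp only:) (simp add: eq_divide_eq mult.commute)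
qed

lemma qbeta_mean_const: "A > 0 \<Longrightarrow> b > -1 \<Longrightarrow> qbeta_mean q A b (\<lambda>_. c) = c"
  using qbeta_total_pos[of A b] qbeta_weight_summable[of A b]
  by (simp add: qbeta_mean_def suminf_mult2[symmetric])

lemma qbeta_mean_power_Suc:
  assumes "A > 0" "b > -1"
  shows "qbeta_mean q A b (\<lambda>t. t ^ Suc m)
           = q_num q A / q_num q (A + b + 1) * qbeta_mean q (A + 1) b (\<lambda>t. t ^ m)"
proof -
  have "(\<lambda>i. qbeta_weight q A b i * (q ^ i) ^ Suc m) = (\<lambda>i. qbeta_weight q (A + 1) b i * (q ^ i) ^ m)"
    by (auto simp: qbeta_weight_A_Suc)
  moreover have "0 < (\<Sum>i. qbeta_weight q (A + 1) b i)"
    using assms by (intro qbeta_total_pos) auto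
  ultimately show ?thesis
    unfolding qbeta_mean_def qbeta_total_shift[OF assms] by (auto simp: zero_less_mult_iff)
qed

lemma qbeta_summable_bounded:
  assumes "A > 0" "b > -1" "\<And>t. 0 \<le> t \<Longrightarrow> t \<le> 1 \<Longrightarrow> \<bar>g t\<bar> \<le> B"
  shows "summable (\<lambda>i. qbeta_weight q A b i * g (q ^ i))"
proof (rule summable_comparison_test')
  show "summable (\<lambda>i. qbeta_weight q A b i * B)"
    by (intro summable_mult2 qbeta_weight_summable assms)
  fix i
  show "norm (qbeta_weight q A b i * g (q ^ i)) \<le> qbeta_weight q A b i * B"
    using assms(3)[of "q ^ i"] qbeta_weight_pos[OF assms(2), of A i] q
    by (simp add: abs_mult power_le_one)
qed

lemma qbeta_mean_lincomb:
  assumes A: "A > 0" "b > -1"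
    and g: "\<And>t. 0 \<le> t \<Longrightarrow> t \<le> 1 \<Longrightarrow> \<bar>g t\<bar> \<le> B" and h: "\<And>t. 0 \<le> t \<Longrightarrow> t \<le> 1 \<Longrightarrow> \<bar>h t\<bar> \<le> C"
  shows "qbeta_mean q A b (\<lambda>t. g t + a * h t) = qbeta_mean q A b g + a * qbeta_mean q A b h"
proof -
  note s = qbeta_summable_bounded[of A b g B, OF A g] qbeta_summable_bounded[of A b h C, OF A h]
  have "(\<lambda>i. qbeta_weight q A b i * (g (q ^ i) + a * h (q ^ i)))
     = (\<lambda>i. qbeta_weight q A b i * g (q ^ i) + a * (qbeta_weight q A b i * h (q ^ i)))"
    by (auto simp: algebra_simps)
  then have "(\<Sum>i. qbeta_weight q A b i * (g (q ^ i) + a * h (q ^ i)))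
     = (\<Sum>i. qbeta_weight q A b i * g (q ^ i)) + a * (\<Sum>i. qbeta_weight q A b i * h (q ^ i))"
    using suminf_add[OF s(1) summable_mult[OF s(2), where c = a]]
      suminf_mult[OF s(2), where c = a] by simp
  then show ?thesis by (simp add: qbeta_mean_def add_divide_distrib)
qed

lemma qbeta_mean_bound:
  assumes A: "A > 0" "b > -1" and g: "\<And>t. 0 \<le> t \<Longrightarrow> t \<le> 1 \<Longrightarrow> \<bar>g t\<bar> \<le> B"
  shows "\<bar>qbeta_mean q A b g\<bar> \<le> B"
proof -
  let ?w = "qbeta_weight q A b"
  note s = qbeta_weight_summable[OF A] and pos = qbeta_total_pos[OF A]
  have le: "norm (?w i * g (q ^ i)) \<le> ?w i * B" for i
    using g[of "q ^ i"] qbeta_weight_pos[OF A(2), of A i] q by (simp add: abs_mult power_le_one)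
  have "norm (\<Sum>i. ?w i * g (q ^ i)) \<le> (\<Sum>i. ?w i * B)"
    by (rule norm_suminf_le[OF le summable_mult2[OF s]])
  also have "\<dots> = suminf ?w * B" using suminf_mult2[OF s, of B] by simp
  finally show ?thesis
    using pos by (simp add: qbeta_mean_def divide_simps mult.commute)
qed

text \<open>
  The ratio of the weights with parameters \<open>(A + 1, b - 1)\<close> and \<open>(A, b)\<close> decreases in \<open>i\<close>, that is, it
  increases in \<open>t = q ^ i\<close>. The difference of the normalised weights therefore changes sign at most
  once, from nonnegative to negative as \<open>i\<close> grows. Subtracting from \<open>g\<close> its value at the change
  of sign makes every term of the difference of the two means nonnegative.
\<close>
lemma qbeta_mean_mono:
  assumes A: "A > 0" "b > 0"
    and g: "\<And>s t. 0 \<le> s \<Longrightarrow> s \<le> t \<Longrightarrow> t \<le> 1 \<Longrightarrow> g s \<le> g t"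
  shows "qbeta_mean q A b g \<le> qbeta_mean q (A + 1) (b - 1) g"
proof -
  define U where "U = (\<Sum>i. qbeta_weight q A b i)"
  define V where "V = (\<Sum>i. qbeta_weight q (A + 1) (b - 1) i)"
  define u where "u i = qbeta_weight q A b i / U" for i
  define v where "v i = qbeta_weight q (A + 1) (b - 1) i / V" for i
  have b: "b > -1" "b - 1 > -1" and A': "A + 1 > 0" using A by auto
  have UV: "0 < U" "0 < V"
    unfolding U_def V_def using qbeta_total_pos A b by auto
  have uv: "0 < u i" "0 < v i" for i
    unfolding u_def v_def using UV qbeta_weight_pos b by auto
  have bd: "\<bar>g t\<bar> \<le> \<bar>g 0\<bar> + \<bar>g 1\<bar>" if "0 \<le> t" "t \<le> 1" for t
    using g[of 0 t] g[of t 1] that by auto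
  have su: "u sums 1" and sv: "v sums 1"
    unfolding u_def v_def using UV b A'
      qbeta_weight_summable[of A b, THEN summable_sums, THEN sums_divide, of U]
      qbeta_weight_summable[of "A + 1" "b - 1", THEN summable_sums, THEN sums_divide, of V] A
    by (simp_all add: U_def[symmetric] V_def[symmetric])
  have "(\<lambda>i. qbeta_weight q A b i * g (q ^ i) / U) sums qbeta_mean q A b g"
    unfolding qbeta_mean_def U_def[symmetric]
    by (intro sums_divide summable_sums qbeta_summable_bounded[OF A(1) b(1) bd])
  then have gu: "(\<lambda>i. u i * g (q ^ i)) sums qbeta_mean q A b g"
    by (simp add: u_def)
  have "(\<lambda>i. qbeta_weight q (A + 1) (b - 1) i * g (q ^ i) / V) sums qbeta_mean q (A + 1) (b - 1) g"
    unfolding qbeta_mean_def V_def[symmetric]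
    by (intro sums_divide summable_sums qbeta_summable_bounded[OF A' b(2) bd])
  then have gv: "(\<lambda>i. v i * g (q ^ i)) sums qbeta_mean q (A + 1) (b - 1) g"
    by (simp add: v_def)
  have step: "v (Suc i) < u (Suc i)" if "v i < u i" for i
  proof -
    have lt: "q ^ Suc i < 1" using q by (simp add: power_less_one_iff del: power_Suc)
    define \<rho> where "\<rho> = q powr A * (1 - q powr (b + 1) * q ^ i)"
    define \<rho>' where "\<rho>' = q powr (A + 1) * (1 - q powr b * q ^ i)"
    have "q powr (b + 1) * q ^ i < 1"
    proof -
      have "q powr (b + 1) * q ^ i \<le> q powr (b + 1) * 1"
        using q by (intro mult_left_mono power_le_one) auto
      also have "\<dots> < 1" using q A by (simp add: powr01_less_one)
      finally show ?thesis .
    qed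
    then have "0 < \<rho>" using q by (simp add: \<rho>_def)
    have "\<rho>' = q powr A * (q - q powr (b + 1) * q ^ i)"
      using q by (simp add: \<rho>'_def powr_add algebra_simps)
    also have "\<dots> \<le> \<rho>" unfolding \<rho>_def using q by (intro mult_left_mono) auto
    finally have "\<rho>' \<le> \<rho>" .
    have "v (Suc i) * (1 - q ^ Suc i) = v i * \<rho>'"
      using qbeta_weight_Suc[OF b(2), of "A + 1" i] by (simp add: v_def \<rho>'_def mult_ac)
    also have "\<dots> \<le> v i * \<rho>" using uv(2)[of i] \<open>\<rho>' \<le> \<rho>\<close> by simp
    also have "\<dots> < u i * \<rho>" using that \<open>0 < \<rho>\<close> by simp
    also have "\<dots> = u (Suc i) * (1 - q ^ Suc i)"
      using qbeta_weight_Suc[OF b(1), of A i] by (simp add: u_def \<rho>_def mult_ac)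
    finally show ?thesis using lt by (simp del: power_Suc)
  qed
  \<comment> \<open>\<open>\<gamma>\<close> is the value of \<open>g\<close> at the first sign change, or at the limit point \<open>0\<close> if there is none.\<close>
  have "\<exists>\<gamma>. \<forall>i. 0 \<le> (v i - u i) * (g (q ^ i) - \<gamma>)"
  proof (cases "\<exists>i. v i < u i")
    case False
    then have "0 \<le> (v i - u i) * (g (q ^ i) - g 0)" for i
      using q by (intro mult_nonneg_nonneg) (auto simp: not_less power_le_one intro!: g)
    then show ?thesis by blast
  next
    case True
    define I where "I = (LEAST i. v i < u i)"
    have I: "v I < u I" unfolding I_def using True by (rule LeastI_ex)
    have after: "v i < u i" if "i \<ge> I" for i
      using that by (induction rule: dec_induct) (use I step in auto)
    have "0 \<le> (v i - u i) * (g (q ^ i) - g (q ^ I))" for i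
    proof (cases "i < I")
      case True
      then have "u i \<le> v i" unfolding I_def using not_less_Least not_less by blast
      moreover have "g (q ^ I) \<le> g (q ^ i)"
        using q True by (intro g) (auto simp: power_le_one power_decreasing)
      ultimately show ?thesis by simp
    next
      case False
      then have "v i < u i" using after by simp
      moreover have "g (q ^ i) \<le> g (q ^ I)"
        using q False by (intro g) (auto simp: power_le_one power_decreasing)
      ultimately show ?thesis by (intro mult_nonpos_nonpos) auto
    qed
    then show ?thesis by blast
  qed
  then obtain \<gamma> where \<gamma>: "\<And>i. 0 \<le> (v i - u i) * (g (q ^ i) - \<gamma>)" by blast
  have "(\<lambda>i. (v i * g (q ^ i) - u i * g (q ^ i)) - (v i * \<gamma> - u i * \<gamma>)) sums
     ((qbeta_mean q (A + 1) (b - 1) g - qbeta_mean q A b g) - (1 * \<gamma> - 1 * \<gamma>))"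
    by (intro sums_diff gu gv sums_mult2 su sv)
  then have "(\<lambda>i. (v i - u i) * (g (q ^ i) - \<gamma>)) sums
     (qbeta_mean q (A + 1) (b - 1) g - qbeta_mean q A b g)"
    by (simp add: algebra_simps)
  from sums_le[OF _ sums_zero this] \<gamma> show ?thesis by simp
qed

end

section \<open>Increments of the Durrmeyer coefficients\<close>

lemma qbeta_moment:
  assumes q: "0 < q" "q < 1" and A: "A > 0" "b > -1"
  shows "qbeta_mean q A b (\<lambda>t. t ^ m)
           = (\<Prod>s<m. q_num q (A + real s) / q_num q (A + b + 1 + real s))"
  using A
proof (induction m arbitrary: A)
  case 0
  then show ?case using qbeta_mean_const[OF q, of A b 1] by simp
next
  case (Suc m)
  have "(\<Prod>s<Suc m. q_num q (A + real s) / q_num q (A + b + 1 + real s))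
     = q_num q A / q_num q (A + b + 1)
       * (\<Prod>s<m. q_num q (A + 1 + real s) / q_num q (A + 1 + b + 1 + real s))"
    by (subst prod.lessThan_Suc_shift) (simp add: algebra_simps)
  then show ?case using Suc qbeta_mean_power_Suc[OF q, of A b m] by (simp del: prod.lessThan_Suc)
qed

lemma q_num_diff:
  assumes "0 < q" "q < 1"
  shows "q_num q (a + 1) - q_num q a = q powr a"
    and "q_num q (a + 2) - q_num q a = q powr a * (1 + q)"
    and "q_num q (a + 3) - q_num q a = q powr a * (1 + q + q\<^sup>2)"
proof -
  have e: "q powr (a + 2) = q powr a * q ^ 2" "q powr (a + 3) = q powr a * q ^ 3"
    using assms powr_realpow[of q 2] powr_realpow[of q 3] by (auto simp: powr_add)
  have "1 - q \<noteq> 0" using assms by simp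
  then show "q_num q (a + 1) - q_num q a = q powr a"
    and "q_num q (a + 2) - q_num q a = q powr a * (1 + q)"
    and "q_num q (a + 3) - q_num q a = q powr a * (1 + q + q\<^sup>2)"
    using assms unfolding q_num_def e
    by (simp_all add: powr_add divide_simps) (simp_all add: algebra_simps power2_eq_square power3_eq_cube)
qed

text \<open>
  The coefficients, in the Bernstein basis of degree \<open>n\<close>, of the derivative of the classical
  Bernstein polynomial of degree \<open>n + 1\<close> with the Durrmeyer coefficients of \<open>g\<close>.
\<close>
definition coeff_slope :: "nat \<Rightarrow> nat \<Rightarrow> real \<Rightarrow> real \<Rightarrow> real \<Rightarrow> (real \<Rightarrow> real) \<Rightarrow> real" where
  "coeff_slope n k q \<alpha> \<beta> g = real (Suc n) *
     (q_durrmeyer_coeff (Suc n) (Suc k) q \<alpha> \<beta> g - q_durrmeyer_coeff (Suc n) k q \<alpha> \<beta> g)"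

context
  fixes q \<alpha> \<beta> :: real
  assumes q: "0 < q" "q < 1" and \<alpha>: "\<alpha> > -1" and \<beta>: "\<beta> > -1"
begin

lemma node_in_unit: "0 \<le> t \<Longrightarrow> t \<le> 1 \<Longrightarrow> 0 \<le> q powr (\<beta> + 1) * t \<and> q powr (\<beta> + 1) * t \<le> 1"
  using powr01_less_one[of q "\<beta> + 1"] q \<beta> by (auto intro!: mult_le_one)

lemma q_durrmeyer_coeff_bound:
  assumes "\<And>t. 0 \<le> t \<Longrightarrow> t \<le> 1 \<Longrightarrow> \<bar>g t\<bar> \<le> B"
  shows "\<bar>q_durrmeyer_coeff n k q \<alpha> \<beta> g\<bar> \<le> B"
  unfolding q_durrmeyer_coeff_eq_qbeta_mean[OF q]
  using \<alpha> \<beta> by (intro qbeta_mean_bound q) (auto intro!: assms simp: node_in_unit)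

lemma q_durrmeyer_coeff_lincomb:
  assumes "\<And>t. 0 \<le> t \<Longrightarrow> t \<le> 1 \<Longrightarrow> \<bar>g t\<bar> \<le> B" "\<And>t. 0 \<le> t \<Longrightarrow> t \<le> 1 \<Longrightarrow> \<bar>h t\<bar> \<le> C"
  shows "q_durrmeyer_coeff n k q \<alpha> \<beta> (\<lambda>t. g t + a * h t)
           = q_durrmeyer_coeff n k q \<alpha> \<beta> g + a * q_durrmeyer_coeff n k q \<alpha> \<beta> h"
  unfolding q_durrmeyer_coeff_eq_qbeta_mean[OF q]
  using \<alpha> \<beta> by (intro qbeta_mean_lincomb[where B = B and C = C] q) (auto intro!: assms simp: node_in_unit)

lemma coeff_slope_lincomb:
  assumes "\<And>t. 0 \<le> t \<Longrightarrow> t \<le> 1 \<Longrightarrow> \<bar>g t\<bar> \<le> B" "\<And>t. 0 \<le> t \<Longrightarrow> t \<le> 1 \<Longrightarrow> \<bar>h t\<bar> \<le> C"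
  shows "coeff_slope n k q \<alpha> \<beta> (\<lambda>t. g t + a * h t)
           = coeff_slope n k q \<alpha> \<beta> g + a * coeff_slope n k q \<alpha> \<beta> h"
  unfolding coeff_slope_def
  by (simp add: q_durrmeyer_coeff_lincomb[of g B h C, OF assms] algebra_simps)

text \<open>
  Passing from \<open>k\<close> to \<open>k + 1\<close> turns the parameters \<open>(A, b)\<close> into \<open>(A + 1, b - 1)\<close>, so this is the
  monotonicity of the means.
\<close>
lemma coeff_slope_nonneg:
  assumes "k \<le> n" and "\<And>s t. 0 \<le> s \<Longrightarrow> s \<le> t \<Longrightarrow> t \<le> 1 \<Longrightarrow> g s \<le> g t"
  shows "0 \<le> coeff_slope n k q \<alpha> \<beta> g"
proof -
  let ?g = "\<lambda>t. g (q powr (\<beta> + 1) * t)"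
  have mono: "?g s \<le> ?g t" if "0 \<le> s" "s \<le> t" "t \<le> 1" for s t
    using that node_in_unit[of s] node_in_unit[of t] q by (intro assms(2)) (auto intro!: mult_left_mono)
  have "qbeta_mean q (real k + \<alpha> + 1) (real (Suc n - k) + \<beta>) ?g
      \<le> qbeta_mean q ((real k + \<alpha> + 1) + 1) ((real (Suc n - k) + \<beta>) - 1) ?g"
    using assms(1) \<alpha> \<beta> by (intro qbeta_mean_mono q mono) (auto simp: Suc_diff_le)
  also have "\<dots> = qbeta_mean q (real (Suc k) + \<alpha> + 1) (real (Suc n - Suc k) + \<beta>) ?g"
    using assms(1) by (simp add: Suc_diff_le algebra_simps)
  finally show ?thesis
    unfolding coeff_slope_def q_durrmeyer_coeff_eq_qbeta_mean[OF q] by simp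
qed

lemma q_durrmeyer_coeff_power:
  assumes "k \<le> n"
  shows "q_durrmeyer_coeff n k q \<alpha> \<beta> (\<lambda>t. t ^ m) = (q powr (\<beta> + 1)) ^ m *
    (\<Prod>s<m. q_num q (real k + \<alpha> + 1 + real s) / q_num q (real n + \<alpha> + \<beta> + 2 + real s))"
proof -
  define A b where "A = real k + \<alpha> + 1" and "b = real (n - k) + \<beta>"
  have A: "A > 0" "b > -1" using \<alpha> \<beta> by (auto simp: A_def b_def)
  have "qbeta_mean q A b (\<lambda>t. 0 + (q powr (\<beta> + 1)) ^ m * t ^ m)
     = 0 + (q powr (\<beta> + 1)) ^ m * qbeta_mean q A b (\<lambda>t. t ^ m)"
    using qbeta_mean_lincomb[OF q A, of "\<lambda>_. 0" 0 "\<lambda>t. t ^ m" 1] qbeta_mean_const[OF q A, of 0]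
    by (simp add: power_le_one)
  moreover have "A + b + 1 = real n + \<alpha> + \<beta> + 2" using assms by (simp add: A_def b_def of_nat_diff)
  ultimately show ?thesis
    unfolding q_durrmeyer_coeff_eq_qbeta_mean[OF q] A_def[symmetric] b_def[symmetric]
    by (simp add: power_mult_distrib qbeta_moment[OF q A])
qed

text \<open>
  The moments at \<open>k\<close> and \<open>k + 1\<close> are products of consecutive ratios of \<open>q\<close>-numbers that share all but
  their extreme factors, so the difference of the two collapses to \<open>q_num (A + m) - q_num A\<close> times the
  common factors.
\<close>
lemma coeff_slope_moments:
  fixes n k :: nat
  assumes k: "k \<le> n"
  defines "A \<equiv> real k + \<alpha> + 1" and "N \<equiv> real n + \<alpha> + \<beta> + 3"
  defines "Z \<equiv> real (Suc n) / q_num q N * q powr A"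
  shows "coeff_slope n k q \<alpha> \<beta> (\<lambda>t. t) = Z * q powr (\<beta> + 1)"
    and "coeff_slope n k q \<alpha> \<beta> (\<lambda>t. t ^ 2) = Z * ((q powr (\<beta> + 1)) ^ 2 * (1 + q))
           * (q_num q (A + 1) / q_num q (N + 1))"
    and "coeff_slope n k q \<alpha> \<beta> (\<lambda>t. t ^ 3) = Z * ((q powr (\<beta> + 1)) ^ 3 * (1 + q + q\<^sup>2))
           * (q_num q (A + 1) / q_num q (N + 1) * (q_num q (A + 2) / q_num q (N + 2)))"
proof -
  note P = q_durrmeyer_coeff_power[of "Suc k" "Suc n"] q_durrmeyer_coeff_power[of k "Suc n"]
  have Pm: "coeff_slope n k q \<alpha> \<beta> (\<lambda>t. t ^ m) = real (Suc n) * (q powr (\<beta> + 1)) ^ m *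
     ((\<Prod>s<m. q_num q (A + 1 + real s) / q_num q (N + real s))
       - (\<Prod>s<m. q_num q (A + real s) / q_num q (N + real s)))" for m
    unfolding coeff_slope_def using k P[of m] by (simp add: A_def N_def algebra_simps)
  have pos: "0 < q_num q N" "0 < q_num q (N + 1)" "0 < q_num q (N + 2)"
    using \<alpha> \<beta> by (auto intro!: q_num_pos q simp: N_def)
  have [simp]: "A + 1 + 1 = A + 2" "A + 1 + 2 = A + 3" by auto
  have "q_num q (A + 1) / q_num q N - q_num q A / q_num q N = q powr A / q_num q N"
    by (simp add: q_num_diff[OF q, symmetric] diff_divide_distrib)
  then show "coeff_slope n k q \<alpha> \<beta> (\<lambda>t. t) = Z * q powr (\<beta> + 1)"
    using Pm[of 1] by (simp add: Z_def)
  have "q_num q (A + 1) / q_num q N * (q_num q (A + 2) / q_num q (N + 1))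
     - q_num q A / q_num q N * (q_num q (A + 1) / q_num q (N + 1))
     = (q powr A * (1 + q)) / q_num q N * (q_num q (A + 1) / q_num q (N + 1))"
    unfolding q_num_diff(2)[OF q, symmetric] by (simp add: algebra_simps diff_divide_distrib)
  then show "coeff_slope n k q \<alpha> \<beta> (\<lambda>t. t ^ 2) = Z * ((q powr (\<beta> + 1)) ^ 2 * (1 + q))
           * (q_num q (A + 1) / q_num q (N + 1))"
    using Pm[of 2] by (simp add: Z_def numeral_2_eq_2)
  have "q_num q (A + 1) / q_num q N * (q_num q (A + 2) / q_num q (N + 1)) * (q_num q (A + 3) / q_num q (N + 2))
     - q_num q A / q_num q N * (q_num q (A + 1) / q_num q (N + 1)) * (q_num q (A + 2) / q_num q (N + 2))
     = (q powr A * (1 + q + q\<^sup>2)) / q_num q N * (q_num q (A + 1) / q_num q (N + 1) * (q_num q (A + 2) / q_num q (N + 2)))"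
    unfolding q_num_diff(3)[OF q, symmetric] by (simp add: algebra_simps diff_divide_distrib)
  moreover have prod3: "prod h {..<3} = h 0 * h 1 * h 2" for h :: "nat \<Rightarrow> real"
    by (simp add: numeral_3_eq_3 numeral_2_eq_2)
  ultimately show "coeff_slope n k q \<alpha> \<beta> (\<lambda>t. t ^ 3) = Z * ((q powr (\<beta> + 1)) ^ 3 * (1 + q + q\<^sup>2))
           * (q_num q (A + 1) / q_num q (N + 1) * (q_num q (A + 2) / q_num q (N + 2)))"
    using Pm[of 3] by (simp add: Z_def prod3)
qed

text \<open>
  The error term is the slope of \<open>\<epsilon> * t + C / 3 * (t - y) ^ 3\<close>, whose derivative dominates that of
  \<open>f t - f' y * t\<close> in absolute value. Both bounds follow from the monotonicity of the slope.
\<close>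
lemma coeff_slope_sandwich:
  assumes k: "k \<le> n" and C: "0 \<le> C" and y: "0 \<le> y" "y \<le> 1"
    and deriv: "\<And>x. x \<in> {0..1} \<Longrightarrow> (f has_real_derivative f' x) (at x within {0..1})"
    and near: "\<And>t. 0 \<le> t \<Longrightarrow> t \<le> 1 \<Longrightarrow> \<bar>f' t - f' y\<bar> \<le> \<epsilon> + C * (t - y)\<^sup>2"
  defines "X1 \<equiv> coeff_slope n k q \<alpha> \<beta> (\<lambda>t. t)" and "X2 \<equiv> coeff_slope n k q \<alpha> \<beta> (\<lambda>t. t ^ 2)"
    and "X3 \<equiv> coeff_slope n k q \<alpha> \<beta> (\<lambda>t. t ^ 3)"
  shows "\<bar>coeff_slope n k q \<alpha> \<beta> f - f' y * X1\<bar>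
           \<le> \<epsilon> * X1 + C * (X3 / 3 - y * X2 + y\<^sup>2 * X1)"
proof -
  have "continuous_on {0..1} f"
    using deriv by (meson DERIV_continuous continuous_on_eq_continuous_within)
  then have "compact (f ` {0..1})" by (intro compact_continuous_image) auto
  then obtain B where B: "\<And>t. 0 \<le> t \<Longrightarrow> t \<le> 1 \<Longrightarrow> \<bar>f t\<bar> \<le> B"
    by (force dest!: compact_imp_bounded simp: bounded_iff)
  have key: "0 \<le> \<epsilon> * X1 + C * (X3 / 3 - y * X2 + y\<^sup>2 * X1)
                + \<sigma> * (coeff_slope n k q \<alpha> \<beta> f - f' y * X1)" if \<sigma>: "\<sigma> = 1 \<or> \<sigma> = -1" for \<sigma>
  proof -
    \<comment> \<open>\<open>g\<close> is \<open>\<sigma> * (f t - f' y * t) + \<epsilon> * t + C / 3 * (t - y) ^ 3\<close> without its constant term.\<close>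
    define a where "a = \<epsilon> + C * y\<^sup>2 - \<sigma> * f' y"
    define g where "g t = ((\<sigma> * f t + a * t) + (- C * y) * t ^ 2) + C / 3 * t ^ 3" for t
    have g1: "(g has_real_derivative \<epsilon> + C * (t - y)\<^sup>2 + \<sigma> * (f' t - f' y)) (at t within {0..1})"
      if "t \<in> {0..1}" for t
      unfolding g_def
      by (rule derivative_eq_intros deriv[OF that] refl)+
        (simp add: a_def algebra_simps power2_eq_square)
    have cont_g: "continuous_on {0..1} g"
      using g1 by (meson DERIV_continuous continuous_on_eq_continuous_within)
    have "g s \<le> g t" if st: "0 \<le> s" "s \<le> t" "t \<le> 1" for s t
    proof (rule DERIV_nonneg_imp_increasing_open[OF st(2)])
      show "continuous_on {s..t} g"
        using cont_g by (rule continuous_on_subset) (use st in auto)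
      fix x assume x: "s < x" "x < t"
      have "at x within {0..1} = at x" using x st by (intro at_within_interior) auto
      moreover have "0 \<le> \<epsilon> + C * (x - y)\<^sup>2 + \<sigma> * (f' x - f' y)"
        using near[of x] x st \<sigma> by auto
      ultimately show "\<exists>z. (g has_real_derivative z) (at x) \<and> 0 \<le> z"
        using g1[of x] x st by auto
    qed
    then have "0 \<le> coeff_slope n k q \<alpha> \<beta> g"
      by (intro coeff_slope_nonneg k)
    also have "coeff_slope n k q \<alpha> \<beta> g = ((\<sigma> * coeff_slope n k q \<alpha> \<beta> f + a * X1) + (- C * y) * X2) + C / 3 * X3"
    proof -
      have p: "\<bar>t ^ m\<bar> \<le> 1" if "0 \<le> t" "t \<le> 1" for t :: real and m
        using that by (simp add: power_le_one)
      have z: "coeff_slope n k q \<alpha> \<beta> (\<lambda>t. 0) = 0"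
        using coeff_slope_lincomb[of "\<lambda>_. 1" 1 "\<lambda>_. 1" 1 n k "-1"] by simp
      have b1: "\<bar>\<sigma> * f t\<bar> \<le> B" if "0 \<le> t" "t \<le> 1" for t
        using B[OF that] \<sigma> by auto
      have b2: "\<bar>\<sigma> * f t + a * t\<bar> \<le> B + \<bar>a\<bar>" if "0 \<le> t" "t \<le> 1" for t
        using abs_triangle_ineq[of "\<sigma> * f t" "a * t"] b1[OF that] that mult_left_le[of t "\<bar>a\<bar>"]
        by (simp add: abs_mult)
      have b3: "\<bar>(\<sigma> * f t + a * t) + (- C * y) * t ^ 2\<bar> \<le> (B + \<bar>a\<bar>) + \<bar>- C * y\<bar>" if "0 \<le> t" "t \<le> 1" for t
        using abs_triangle_ineq[of "\<sigma> * f t + a * t" "(- C * y) * t ^ 2"] b2[OF that] p[OF that, of 2]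
          mult_left_le[of "t ^ 2" "\<bar>- C * y\<bar>"]
        by (simp add: abs_mult)
      have e1: "coeff_slope n k q \<alpha> \<beta> (\<lambda>t. \<sigma> * f t) = \<sigma> * coeff_slope n k q \<alpha> \<beta> f"
        using coeff_slope_lincomb[of "\<lambda>_. 0" 0 f B n k \<sigma>] B z by simp
      have e2: "coeff_slope n k q \<alpha> \<beta> (\<lambda>t. \<sigma> * f t + a * t)
          = coeff_slope n k q \<alpha> \<beta> (\<lambda>t. \<sigma> * f t) + a * X1"
        unfolding X1_def by (rule coeff_slope_lincomb[OF b1, where C = 1]) auto
      have e3: "coeff_slope n k q \<alpha> \<beta> (\<lambda>t. (\<sigma> * f t + a * t) + (- C * y) * t ^ 2)
          = coeff_slope n k q \<alpha> \<beta> (\<lambda>t. \<sigma> * f t + a * t) + (- C * y) * X2"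
        unfolding X2_def by (rule coeff_slope_lincomb[OF b2, where C = 1]) (auto simp: power_le_one)
      have e4: "coeff_slope n k q \<alpha> \<beta> g
          = coeff_slope n k q \<alpha> \<beta> (\<lambda>t. (\<sigma> * f t + a * t) + (- C * y) * t ^ 2) + C / 3 * X3"
        unfolding X3_def g_def by (rule coeff_slope_lincomb[OF b3, where C = 1]) (auto simp: power_le_one)
      show ?thesis by (simp only: e1 e2 e3 e4)
    qed
    also have "\<dots> = \<epsilon> * X1 + C * (X3 / 3 - y * X2 + y\<^sup>2 * X1)
                + \<sigma> * (coeff_slope n k q \<alpha> \<beta> f - f' y * X1)"
      by (simp add: a_def algebra_simps)
    finally show ?thesis .
  qed
  show ?thesis using key[of 1] key[of "-1"] by (intro abs_leI) simp_all
qed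

end

section \<open>Asymptotics as q tends to 1\<close>

lemma tendsto_bounded_mult_0:
  fixes X y :: "nat \<Rightarrow> real"
  assumes "X \<longlonglongrightarrow> 0" "\<And>n. \<bar>y n\<bar> \<le> 1"
  shows "(\<lambda>n. y n * X n) \<longlonglongrightarrow> 0"
proof (rule Lim_null_comparison)
  show "\<forall>\<^sub>F n in sequentially. norm (y n * X n) \<le> \<bar>X n\<bar>"
    using assms(2) by (auto simp: abs_mult mult_left_le_one_le)
  show "(\<lambda>n. \<bar>X n\<bar>) \<longlonglongrightarrow> 0" using assms(1) by (rule tendsto_rabs_zero)
qed

lemma const_over_shifted_tendsto_0: "(\<lambda>n. c / (real n + b)) \<longlonglongrightarrow> 0"
proof -
  have "filterlim (\<lambda>n. b + real n) at_top sequentially"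
    by (rule filterlim_tendsto_add_at_top[OF tendsto_const filterlim_real_sequentially])
  then show ?thesis
    by (intro real_tendsto_divide_at_top[OF tendsto_const]) (simp add: add.commute)
qed

text \<open>
  A null sequence along every choice of indices \<open>\<kappa> n \<le> n\<close> is a limit that is uniform in the index: let
  \<open>\<kappa>\<close> pick a violating index wherever there is one.
\<close>
lemma eventually_all_le_if_sequences:
  fixes G :: "nat \<Rightarrow> nat \<Rightarrow> real"
  assumes "\<And>\<kappa>. (\<And>n. \<kappa> n \<le> n) \<Longrightarrow> (\<lambda>n. G n (\<kappa> n)) \<longlonglongrightarrow> 0" and e: "0 < e"
  shows "\<forall>\<^sub>F n in sequentially. \<forall>k\<le>n. \<bar>G n k\<bar> < e"
proof -
  define \<kappa> where "\<kappa> n = (if \<exists>k\<le>n. e \<le> \<bar>G n k\<bar> then SOME k. k \<le> n \<and> e \<le> \<bar>G n k\<bar> else 0)" for n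
  have \<kappa>: "\<kappa> n \<le> n \<and> ((\<exists>k\<le>n. e \<le> \<bar>G n k\<bar>) \<longrightarrow> e \<le> \<bar>G n (\<kappa> n)\<bar>)" for n
    unfolding \<kappa>_def using someI_ex[of "\<lambda>k. k \<le> n \<and> e \<le> \<bar>G n k\<bar>"] by auto
  then have "(\<lambda>n. \<bar>G n (\<kappa> n)\<bar>) \<longlonglongrightarrow> 0"
    by (intro tendsto_rabs_zero assms(1)) auto
  then have "\<forall>\<^sub>F n in sequentially. \<bar>G n (\<kappa> n)\<bar> < e"
    using e by (rule order_tendstoD(2))
  then show ?thesis
  proof eventually_elim
    case (elim n)
    then show ?case using \<kappa>[of n] by (meson not_le)
  qed
qed

context
  fixes Q :: "nat \<Rightarrow> real"
  assumes Q: "\<And>n. 0 < Q n" "\<And>n. Q n < 1" and fast: "(\<lambda>n. real n * (1 - Q n)) \<longlonglongrightarrow> 0"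
begin

lemma base_tendsto_1: "Q \<longlonglongrightarrow> 1"
proof -
  have "(\<lambda>n. 1 - Q n) \<longlonglongrightarrow> 0"
  proof (rule Lim_null_comparison[OF _ fast])
    show "\<forall>\<^sub>F n in sequentially. norm (1 - Q n) \<le> real n * (1 - Q n)"
      using eventually_ge_at_top[of 1]
    proof eventually_elim
      case (elim n)
      then show ?case using Q(2)[of n] mult_right_mono[of 1 "real n" "1 - Q n"] by simp
    qed
  qed
  then show ?thesis using tendsto_diff[OF tendsto_const[of 1]] by fastforce
qed

text \<open>
  The exponent grows at most linearly, while \<open>ln (Q n)\<close> is of the order of \<open>1 - Q n\<close>, which is
  \<open>o(1 / n)\<close>.
\<close>
lemma powr_tendsto_1:
  assumes a: "\<And>n. \<bar>a n\<bar> \<le> real n + C"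
  shows "(\<lambda>n. Q n powr a n) \<longlonglongrightarrow> 1"
proof -
  have "(\<lambda>n. (real n * (1 - Q n) + C * (1 - Q n)) / Q n) \<longlonglongrightarrow> (0 + C * (1 - 1)) / 1"
    by (intro tendsto_intros fast base_tendsto_1) auto
  then have lim: "(\<lambda>n. (real n + C) * (1 - Q n) / Q n) \<longlonglongrightarrow> 0" by (simp add: algebra_simps)
  have "(\<lambda>n. a n * ln (Q n)) \<longlonglongrightarrow> 0"
  proof (rule Lim_null_comparison[OF _ lim], rule always_eventually, rule allI)
    fix n
    have "\<bar>ln (Q n)\<bar> = ln (1 / Q n)" using Q[of n] by (simp add: ln_div ln_less_zero)
    also have "\<dots> \<le> 1 / Q n - 1" using Q[of n] by (intro ln_le_minus_one) auto
    also have "\<dots> = (1 - Q n) / Q n" using Q(1)[of n] by (simp add: field_simps)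
    finally have "\<bar>a n\<bar> * \<bar>ln (Q n)\<bar> \<le> (real n + C) * ((1 - Q n) / Q n)"
      using a[of n] by (intro mult_mono) auto
    then show "norm (a n * ln (Q n)) \<le> (real n + C) * (1 - Q n) / Q n" by (simp add: abs_mult)
  qed
  then have "(\<lambda>n. exp (a n * ln (Q n))) \<longlonglongrightarrow> exp 0" by (rule tendsto_exp)
  then show ?thesis using Q(1) by (simp add: powr_def order.strict_implies_not_eq[THEN not_sym])
qed

text \<open>
  By the mean value theorem \<open>q_num q a = a * z powr (a - 1)\<close> with \<open>q < z < 1\<close>, and \<open>z powr (a - 1)\<close>
  lies between two powers of \<open>q\<close> that tend to \<open>1\<close>.
\<close>
lemma q_num_over_tendsto_1:
  assumes a: "\<And>n. 0 < a n" "\<And>n. a n \<le> real n + C"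
  shows "(\<lambda>n. q_num (Q n) (a n) / a n) \<longlonglongrightarrow> 1"
proof (rule tendsto_sandwich)
  have "\<bar>\<bar>a n - 1\<bar>\<bar> \<le> real n + (\<bar>C\<bar> + 1)" "\<bar>- \<bar>a n - 1\<bar>\<bar> \<le> real n + (\<bar>C\<bar> + 1)" for n
    using a[of n] by auto
  then show "(\<lambda>n. Q n powr \<bar>a n - 1\<bar>) \<longlonglongrightarrow> 1" "(\<lambda>n. Q n powr (- \<bar>a n - 1\<bar>)) \<longlonglongrightarrow> 1"
    using powr_tendsto_1[of "\<lambda>n. \<bar>a n - 1\<bar>" "\<bar>C\<bar> + 1"]
      powr_tendsto_1[of "\<lambda>n. - \<bar>a n - 1\<bar>" "\<bar>C\<bar> + 1"] by blast+
  have both: "Q n powr \<bar>a n - 1\<bar> \<le> q_num (Q n) (a n) / a n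
      \<and> q_num (Q n) (a n) / a n \<le> Q n powr (- \<bar>a n - 1\<bar>)" for n
  proof -
    note q = Q[of n]
    have "\<exists>z. Q n < z \<and> z < 1 \<and> 1 powr a n - Q n powr a n = (1 - Q n) * (a n * z powr (a n - 1))"
      using q by (intro MVT2) (auto intro!: derivative_eq_intros)
    then obtain z where z: "Q n < z" "z < 1"
      and eq: "1 - Q n powr a n = (1 - Q n) * (a n * z powr (a n - 1))" by auto
    have "q_num (Q n) (a n) / a n = z powr (a n - 1)"
      unfolding q_num_def eq using q a(1)[of n] by simp
    moreover have "Q n powr \<bar>a n - 1\<bar> \<le> z powr \<bar>a n - 1\<bar>"
      using q z by (intro powr_mono2) auto
    moreover have "z powr \<bar>a n - 1\<bar> \<le> z powr (a n - 1)" "z powr (a n - 1) \<le> z powr (- \<bar>a n - 1\<bar>)"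
      using q z by (auto intro!: powr_mono')
    moreover have "z powr (- \<bar>a n - 1\<bar>) \<le> Q n powr (- \<bar>a n - 1\<bar>)"
      using q z by (intro powr_mono2') auto
    ultimately show ?thesis by simp
  qed
  show "\<forall>\<^sub>F n in sequentially. Q n powr \<bar>a n - 1\<bar> \<le> q_num (Q n) (a n) / a n"
    "\<forall>\<^sub>F n in sequentially. q_num (Q n) (a n) / a n \<le> Q n powr (- \<bar>a n - 1\<bar>)"
    using both by auto
qed

lemma q_num_ratio_asymp:
  fixes a b :: real and \<kappa> :: "nat \<Rightarrow> nat"
  assumes \<kappa>: "\<And>n. \<kappa> n \<le> n" and ab: "0 < a" "0 < b"
  shows "(\<lambda>n. q_num (Q n) (real (\<kappa> n) + a) / q_num (Q n) (real n + b) - real (\<kappa> n) / real n) \<longlonglongrightarrow> 0"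
proof -
  define y where "y n = real (\<kappa> n) / real n" for n
  define \<rho> where "\<rho> n = (q_num (Q n) (real (\<kappa> n) + a) / (real (\<kappa> n) + a))
                      / (q_num (Q n) (real n + b) / (real n + b))" for n
  have y: "\<bar>y n\<bar> \<le> 1" for n using \<kappa>[of n] by (auto simp: y_def divide_le_eq_1)
  have "\<rho> \<longlonglongrightarrow> 1 / 1"
    unfolding \<rho>_def using ab \<kappa>
    by (intro tendsto_divide q_num_over_tendsto_1[where C = a] q_num_over_tendsto_1[where C = b])
      (auto intro: add_nonneg_pos)
  then have \<rho>: "\<rho> \<longlonglongrightarrow> 1" by simp
  have d: "(\<lambda>n. (real (\<kappa> n) + a) / (real n + b) - y n) \<longlonglongrightarrow> 0"
  proof (rule Lim_null_comparison[OF _ const_over_shifted_tendsto_0])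
    show "\<forall>\<^sub>F n in sequentially. norm ((real (\<kappa> n) + a) / (real n + b) - y n) \<le> (a + b) / (real n + b)"
      using eventually_gt_at_top[of 0]
    proof eventually_elim
      case (elim n)
      have "(real (\<kappa> n) + a) / (real n + b) - y n = (a - b * y n) / (real n + b)"
        using elim ab by (simp add: y_def divide_simps) (simp add: algebra_simps)
      moreover have "\<bar>a - b * y n\<bar> \<le> a + b"
      proof -
        have "\<bar>b * y n\<bar> \<le> b" using y[of n] ab by (simp add: abs_mult mult_left_le)
        then show ?thesis using abs_triangle_ineq4[of a "b * y n"] ab by linarith
      qed
      ultimately show ?case using ab by (simp add: divide_right_mono)
    qed
  qed
  have "(\<lambda>n. \<rho> n * ((real (\<kappa> n) + a) / (real n + b) - y n) + y n * (\<rho> n - 1)) \<longlonglongrightarrow> 1 * 0 + 0"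
    using tendsto_diff[OF \<rho> tendsto_const[of 1]]
    by (intro tendsto_add tendsto_mult \<rho> d tendsto_bounded_mult_0 y) simp
  moreover have "q_num (Q n) (real (\<kappa> n) + a) / q_num (Q n) (real n + b)
      = \<rho> n * ((real (\<kappa> n) + a) / (real n + b))" for n
  proof -
    have "real (\<kappa> n) + a \<noteq> 0" "real n + b \<noteq> 0" using ab by linarith+
    then show ?thesis by (simp add: \<rho>_def)
  qed
  ultimately show ?thesis by (simp add: y_def[symmetric] algebra_simps)
qed

text \<open>
  In the limit the slope of \<open>t ^ m\<close> is the derivative \<open>m * y ^ (m - 1)\<close>: the prefactor \<open>Z\<close> tends to \<open>1\<close>,
  the powers of \<open>q\<close> disappear, \<open>1 + q\<close> and \<open>1 + q + q\<^sup>2\<close> tend to \<open>2\<close> and \<open>3\<close>, and each remaining ratio of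
  \<open>q\<close>-numbers is asymptotic to \<open>y\<close>.
\<close>
lemma coeff_slope_moment_limits:
  assumes \<alpha>: "\<alpha> > -1" and \<beta>: "\<beta> > -1" and \<kappa>: "\<And>n. \<kappa> n \<le> n"
  defines "y \<equiv> \<lambda>n. real (\<kappa> n) / real n"
  shows "(\<lambda>n. coeff_slope n (\<kappa> n) (Q n) \<alpha> \<beta> (\<lambda>t. t)) \<longlonglongrightarrow> 1"
    and "(\<lambda>n. coeff_slope n (\<kappa> n) (Q n) \<alpha> \<beta> (\<lambda>t. t ^ 2) - 2 * y n) \<longlonglongrightarrow> 0"
    and "(\<lambda>n. coeff_slope n (\<kappa> n) (Q n) \<alpha> \<beta> (\<lambda>t. t ^ 3) - 3 * (y n)\<^sup>2) \<longlonglongrightarrow> 0"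
proof -
  define s where "s n = Q n powr (\<beta> + 1)" for n
  define N where "N n = real n + \<alpha> + \<beta> + 3" for n
  define Z where "Z n = real (Suc n) / q_num (Q n) (N n) * Q n powr (real (\<kappa> n) + \<alpha> + 1)" for n
  define R1 where "R1 n = q_num (Q n) (real (\<kappa> n) + \<alpha> + 1 + 1) / q_num (Q n) (N n + 1)" for n
  define R2 where "R2 n = q_num (Q n) (real (\<kappa> n) + \<alpha> + 1 + 2) / q_num (Q n) (N n + 2)" for n
  have y: "\<bar>y n\<bar> \<le> 1" for n using \<kappa>[of n] by (auto simp: y_def divide_le_eq_1)
  have r1: "(\<lambda>n. R1 n - y n) \<longlonglongrightarrow> 0"
    using q_num_ratio_asymp[of \<kappa> "\<alpha> + 1 + 1" "\<alpha> + \<beta> + 3 + 1"] \<kappa> \<alpha> \<beta>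
    by (simp add: R1_def N_def y_def add_ac)
  have r2: "(\<lambda>n. R2 n - y n) \<longlonglongrightarrow> 0"
    using q_num_ratio_asymp[of \<kappa> "\<alpha> + 1 + 2" "\<alpha> + \<beta> + 3 + 2"] \<kappa> \<alpha> \<beta>
    by (simp add: R2_def N_def y_def add_ac)
  have s: "s \<longlonglongrightarrow> 1"
    unfolding s_def using \<beta> by (intro powr_tendsto_1[where C = "\<beta> + 1"]) auto
  have p: "(\<lambda>n. Q n powr (real (\<kappa> n) + \<alpha> + 1)) \<longlonglongrightarrow> 1"
    using \<alpha> \<kappa> by (intro powr_tendsto_1[where C = "\<alpha> + 1"]) (auto simp: abs_le_iff algebra_simps intro: add_mono)
  have "(\<lambda>n. q_num (Q n) (N n) / N n) \<longlonglongrightarrow> 1"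
    using \<alpha> \<beta> by (intro q_num_over_tendsto_1[where C = "\<alpha> + \<beta> + 3"]) (auto simp: N_def)
  moreover have "(\<lambda>n. real (Suc n) / N n) \<longlonglongrightarrow> 1"
  proof -
    have "(\<lambda>n. 1 - (\<alpha> + \<beta> + 2) / (real n + (\<alpha> + \<beta> + 3))) \<longlonglongrightarrow> 1 - 0"
      by (intro tendsto_diff tendsto_const const_over_shifted_tendsto_0)
    moreover have "1 - (\<alpha> + \<beta> + 2) / (real n + (\<alpha> + \<beta> + 3)) = real (Suc n) / N n" for n
      using \<alpha> \<beta> by (simp add: N_def field_simps)
    ultimately show ?thesis by simp
  qed
  ultimately have "(\<lambda>n. (real (Suc n) / N n) / (q_num (Q n) (N n) / N n) * Q n powr (real (\<kappa> n) + \<alpha> + 1)) \<longlonglongrightarrow> 1 / 1 * 1"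
    using p by (intro tendsto_intros) auto
  moreover have "N n \<noteq> 0" for n using \<alpha> \<beta> by (auto simp: N_def)
  ultimately have Z: "Z \<longlonglongrightarrow> 1" unfolding Z_def by simp
  note M = coeff_slope_moments[OF Q(1) Q(2) \<alpha> \<beta> \<kappa>, folded N_def, folded s_def]
  have "(\<lambda>n. Z n * s n) \<longlonglongrightarrow> 1 * 1" by (intro tendsto_intros Z s)
  then show "(\<lambda>n. coeff_slope n (\<kappa> n) (Q n) \<alpha> \<beta> (\<lambda>t. t)) \<longlonglongrightarrow> 1"
    unfolding M(1) Z_def by simp
  have Z2: "(\<lambda>n. Z n * (s n ^ 2 * (1 + Q n))) \<longlonglongrightarrow> 1 * (1 ^ 2 * (1 + 1))"
    by (intro tendsto_intros Z s base_tendsto_1)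
  have "(\<lambda>n. (Z n * (s n ^ 2 * (1 + Q n))) * (R1 n - y n) + y n * (Z n * (s n ^ 2 * (1 + Q n)) - 2)) \<longlonglongrightarrow> 2 * 0 + 0"
    using tendsto_diff[OF Z2 tendsto_const[of 2]] Z2
    by (intro tendsto_add tendsto_mult[OF _ r1] tendsto_bounded_mult_0 y) auto
  then show "(\<lambda>n. coeff_slope n (\<kappa> n) (Q n) \<alpha> \<beta> (\<lambda>t. t ^ 2) - 2 * y n) \<longlonglongrightarrow> 0"
    unfolding M(2) Z_def[symmetric] R1_def[symmetric] by (simp add: algebra_simps)
  have Z3: "(\<lambda>n. Z n * (s n ^ 3 * (1 + Q n + (Q n)\<^sup>2))) \<longlonglongrightarrow> 1 * (1 ^ 3 * (1 + 1 + 1\<^sup>2))"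
    by (intro tendsto_intros Z s base_tendsto_1)
  have "(\<lambda>n. (R1 n - y n) * (R2 n - y n) + (y n * (R1 n - y n) + y n * (R2 n - y n))) \<longlonglongrightarrow> 0 * 0 + (0 + 0)"
    by (intro tendsto_add tendsto_mult r1 r2 tendsto_bounded_mult_0 y)
  then have r12: "(\<lambda>n. R1 n * R2 n - (y n)\<^sup>2) \<longlonglongrightarrow> 0"
    by (simp add: algebra_simps power2_eq_square)
  have y2: "\<bar>(y n)\<^sup>2\<bar> \<le> 1" for n using y[of n] by (simp add: abs_square_le_1)
  have "(\<lambda>n. (Z n * (s n ^ 3 * (1 + Q n + (Q n)\<^sup>2))) * (R1 n * R2 n - (y n)\<^sup>2)
          + (y n)\<^sup>2 * (Z n * (s n ^ 3 * (1 + Q n + (Q n)\<^sup>2)) - 3)) \<longlonglongrightarrow> 3 * 0 + 0"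
    using tendsto_diff[OF Z3 tendsto_const[of 3]] Z3
    by (intro tendsto_add tendsto_mult[OF _ r12] tendsto_bounded_mult_0 y2) auto
  then show "(\<lambda>n. coeff_slope n (\<kappa> n) (Q n) \<alpha> \<beta> (\<lambda>t. t ^ 3) - 3 * (y n)\<^sup>2) \<longlonglongrightarrow> 0"
    unfolding M(3) Z_def[symmetric] R1_def[symmetric] R2_def[symmetric] by (simp add: algebra_simps)
qed

text \<open>
  The modulus of continuity of \<open>f'\<close> supplies the quadratic majorant for \<open>coeff_slope_sandwich\<close>: within
  \<open>\<delta>\<close> of \<open>y\<close> the constant \<open>e / 2\<close> suffices, and further away \<open>C = 2 * K / \<delta>\<^sup>2\<close> makes the quadratic
  term at least \<open>2 * K\<close>, where \<open>K\<close> bounds \<open>\<bar>f'\<bar>\<close>. The resulting bound \<open>E\<close> on the error tends to \<open>e / 2\<close>.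
\<close>
lemma coeff_slope_asymp:
  assumes \<alpha>: "\<alpha> > -1" and \<beta>: "\<beta> > -1" and \<kappa>: "\<And>n. \<kappa> n \<le> n"
    and deriv: "\<And>x. x \<in> {0..1} \<Longrightarrow> (f has_real_derivative f' x) (at x within {0..1})"
    and cont: "continuous_on {0..1} f'"
  shows "(\<lambda>n. coeff_slope n (\<kappa> n) (Q n) \<alpha> \<beta> f - f' (real (\<kappa> n) / real n)) \<longlonglongrightarrow> 0"
proof (rule tendstoI)
  fix e :: real assume e: "0 < e"
  define y where "y n = real (\<kappa> n) / real n" for n
  define X1 where "X1 n = coeff_slope n (\<kappa> n) (Q n) \<alpha> \<beta> (\<lambda>t. t)" for n
  define X2 where "X2 n = coeff_slope n (\<kappa> n) (Q n) \<alpha> \<beta> (\<lambda>t. t ^ 2)" for n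
  define X3 where "X3 n = coeff_slope n (\<kappa> n) (Q n) \<alpha> \<beta> (\<lambda>t. t ^ 3)" for n
  have X1: "X1 \<longlonglongrightarrow> 1" and X2: "(\<lambda>n. X2 n - 2 * y n) \<longlonglongrightarrow> 0" and X3: "(\<lambda>n. X3 n - 3 * (y n)\<^sup>2) \<longlonglongrightarrow> 0"
    using coeff_slope_moment_limits[of \<alpha> \<beta> \<kappa>] \<alpha> \<beta> \<kappa> by (simp_all add: X1_def[abs_def] X2_def X3_def y_def)
  have y: "0 \<le> y n" "y n \<le> 1" for n using \<kappa>[of n] by (auto simp: y_def divide_le_eq_1)
  have "compact (f' ` {0..1})" using cont by (intro compact_continuous_image) auto
  then obtain K where K: "\<And>t. 0 \<le> t \<Longrightarrow> t \<le> 1 \<Longrightarrow> \<bar>f' t\<bar> \<le> K"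
    by (force dest!: compact_imp_bounded simp: bounded_iff)
  have K0: "0 \<le> K" using K[of 0] by simp
  have "uniformly_continuous_on {0..1} f'" using cont by (intro compact_uniformly_continuous) auto
  then obtain \<delta> where \<delta>: "0 < \<delta>"
    and near: "\<And>t u. t \<in> {0..1} \<Longrightarrow> u \<in> {0..1} \<Longrightarrow> dist t u < \<delta> \<Longrightarrow> dist (f' t) (f' u) < e / 2"
    using e unfolding uniformly_continuous_on_def by (metis half_gt_zero)
  define C where "C = 2 * K / \<delta>\<^sup>2"
  have C: "0 \<le> C" using K0 by (simp add: C_def)
  have quad: "\<bar>f' t - f' u\<bar> \<le> e / 2 + C * (t - u)\<^sup>2" if "0 \<le> t" "t \<le> 1" "0 \<le> u" "u \<le> 1" for t u
  proof (cases "\<bar>t - u\<bar> < \<delta>")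
    case True
    then show ?thesis using near[of t u] that C by (simp add: dist_real_def add_increasing2 less_imp_le)
  next
    case False
    then have "\<delta>\<^sup>2 \<le> (t - u)\<^sup>2" using \<delta> by (simp add: abs_le_square_iff[symmetric])
    then have "C * \<delta>\<^sup>2 \<le> C * (t - u)\<^sup>2" using C by (rule mult_left_mono)
    then have "2 * K \<le> C * (t - u)\<^sup>2" using \<delta> by (simp add: C_def)
    then show ?thesis using K[of t] K[of u] that e by linarith
  qed
  define E where "E n = e / 2 * X1 n + C * (X3 n / 3 - y n * X2 n + (y n)\<^sup>2 * X1 n) + K * \<bar>X1 n - 1\<bar>" for n
  have bound: "\<bar>coeff_slope n (\<kappa> n) (Q n) \<alpha> \<beta> f - f' (y n)\<bar> \<le> E n" for n
  proof -
    have "\<bar>coeff_slope n (\<kappa> n) (Q n) \<alpha> \<beta> f - f' (y n) * X1 n\<bar>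
        \<le> e / 2 * X1 n + C * (X3 n / 3 - y n * X2 n + (y n)\<^sup>2 * X1 n)"
      unfolding X1_def X2_def X3_def
      by (rule coeff_slope_sandwich[OF Q(1) Q(2) \<alpha> \<beta> \<kappa> C y deriv]) (auto intro: quad y)
    moreover have "\<bar>f' (y n) * (X1 n - 1)\<bar> \<le> K * \<bar>X1 n - 1\<bar>"
      using K[OF y[of n]] by (simp add: abs_mult mult_right_mono)
    ultimately show ?thesis unfolding E_def by (simp add: algebra_simps)
  qed
  have yy: "\<bar>y n\<bar> \<le> 1" "\<bar>(y n)\<^sup>2\<bar> \<le> 1" for n using y[of n] by (auto simp: abs_square_le_1)
  have X1': "(\<lambda>n. X1 n - 1) \<longlonglongrightarrow> 0" using tendsto_diff[OF X1 tendsto_const[of 1]] by simp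
  \<comment> \<open>\<open>X3 / 3 - y * X2 + y\<^sup>2 * X1\<close> is a combination of the three moment errors, because
  \<open>y\<^sup>2 - y * (2 * y) + y\<^sup>2 = 0\<close>.\<close>
  have "(\<lambda>n. e / 2 * X1 n + C * ((X3 n - 3 * (y n)\<^sup>2) / 3 - y n * (X2 n - 2 * y n) + (y n)\<^sup>2 * (X1 n - 1))
       + K * \<bar>X1 n - 1\<bar>) \<longlonglongrightarrow> e / 2 * 1 + C * (0 / 3 - 0 + 0) + K * \<bar>1 - 1\<bar>"
    by (intro tendsto_intros X1 X3 tendsto_bounded_mult_0 X2 X1' yy) simp
  moreover have "e / 2 * X1 n + C * ((X3 n - 3 * (y n)\<^sup>2) / 3 - y n * (X2 n - 2 * y n) + (y n)\<^sup>2 * (X1 n - 1))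
       + K * \<bar>X1 n - 1\<bar> = E n" for n
    by (simp add: E_def field_simps power2_eq_square)
  ultimately have "E \<longlonglongrightarrow> e / 2" by simp
  then have "\<forall>\<^sub>F n in sequentially. E n < e" using e by (intro order_tendstoD(2)[of E "e / 2"]) auto
  then show "\<forall>\<^sub>F n in sequentially. dist (coeff_slope n (\<kappa> n) (Q n) \<alpha> \<beta> f - f' (real (\<kappa> n) / real n)) 0 < e"
  proof eventually_elim
    case (elim n)
    then show ?case using bound[of n] unfolding y_def dist_real_def by simp
  qed
qed

end

section \<open>Uniform convergence of the derivatives\<close>

text \<open>
  The derivative of \<open>M\<^sub>n\<^sub>+\<^sub>1 f\<close> is compared with that of the classical Bernstein polynomial with the same
  coefficients, using \<open>1 - q ^ (m - k) \<le> m * (1 - q)\<close> from Bernoulli's inequality.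
\<close>
lemma deriv_q_durrmeyer_approx:
  assumes q: "0 < q" "q < 1" and \<alpha>: "\<alpha> > -1" and \<beta>: "\<beta> > -1" and x: "0 \<le> x" "x \<le> 1"
    and B: "\<And>t. 0 \<le> t \<Longrightarrow> t \<le> 1 \<Longrightarrow> \<bar>f t\<bar> \<le> B"
  shows "\<bar>deriv (q_durrmeyer (Suc n) q \<alpha> \<beta> f) x
           - (\<Sum>k\<le>n. coeff_slope n k q \<alpha> \<beta> f * Bernstein n k x)\<bar>
         \<le> 2 * B * (1 - q) * real (Suc n) ^ 3"
proof -
  define r where "r n k = q ^ (n - k)" for n k :: nat
  define c where "c k = q_durrmeyer_coeff (Suc n) k q \<alpha> \<beta> f" for k
  have p: "q_durrmeyer (Suc n) q \<alpha> \<beta> f = (\<lambda>x. casteljau r (Suc n) c x)"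
    using q_bernstein_eq_casteljau[OF q, of c "Suc n"]
    by (simp add: fun_eq_iff q_durrmeyer_def c_def[symmetric] r_def[abs_def] atLeast0AtMost)
  have D: "deriv (q_durrmeyer (Suc n) q \<alpha> \<beta> f) x = casteljau' r (Suc n) c x"
    unfolding p by (rule DERIV_imp_deriv[OF casteljau_has_real_derivative])
  have "(\<Sum>k\<le>n. coeff_slope n k q \<alpha> \<beta> f * Bernstein n k x) = casteljau' (\<lambda>_ _. 1) (Suc n) c x"
    unfolding casteljau'_one_Suc casteljau_one_eq_Bernstein coeff_slope_def c_def
    by (simp add: sum_distrib_left mult.assoc)
  moreover have "\<bar>casteljau' r (Suc n) c x - casteljau' (\<lambda>_ _. 1) (Suc n) c x\<bar>
      \<le> 2 * B * (1 - q) * real (Suc n) ^ 3"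
  proof (rule casteljau_perturbation[THEN conjunct2])
    fix m k :: nat
    assume "k \<le> m"
    show "0 \<le> r m k \<and> r m k \<le> 1" using q by (simp add: r_def power_le_one)
    have "1 + real m * (q - 1) \<le> (1 + (q - 1)) ^ m" using q by (intro Bernoulli_inequality) auto
    also have "\<dots> \<le> r m k" using q by (simp add: r_def power_decreasing)
    finally show "1 - r m k \<le> real m * (1 - q)" by (simp add: algebra_simps)
  next
    show "\<bar>c k\<bar> \<le> B" for k
      unfolding c_def by (intro q_durrmeyer_coeff_bound q \<alpha> \<beta> B)
  qed (use x in auto)
  ultimately show ?thesis unfolding D by simp
qed

theorem corollary3:
  fixes \<alpha> \<beta> :: real and f f' :: "real \<Rightarrow> real" and q :: "nat \<Rightarrow> real"
  assumes "\<alpha> > -1" and "\<beta> > -1"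
    and "\<And>x. x \<in> {0..1} \<Longrightarrow> (f has_real_derivative f' x) (at x within {0..1})"
    and "continuous_on {0..1} f'"
    and "\<And>n. n \<ge> 1 \<Longrightarrow> q n \<in> {0<..<1}"
    and "(\<lambda>n. 1 - q n) \<in> o(\<lambda>n. 1 / real n ^ 4)"
  shows "uniform_limit {0..1} (\<lambda>n x. deriv (q_durrmeyer n (q n) \<alpha> \<beta> f) x) f' sequentially"
proof (rule uniform_limitI)
  fix e :: real assume e: "0 < e"
  define Q where "Q n = q (Suc n)" for n
  have Q: "0 < Q n" "Q n < 1" for n using assms(5)[of "Suc n"] by (auto simp: Q_def)
  have "(\<lambda>n. real n ^ 4 * (1 - q n)) \<longlonglongrightarrow> 0"
    using smalloD_tendsto[OF assms(6)] by (simp add: mult.commute)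
  then have four: "(\<lambda>n. real (Suc n) ^ 4 * (1 - Q n)) \<longlonglongrightarrow> 0"
    unfolding Q_def by (rule LIMSEQ_Suc)
  have three: "(\<lambda>n. real (Suc n) ^ 3 * (1 - Q n)) \<longlonglongrightarrow> 0"
  proof (rule Lim_null_comparison[OF _ four], rule always_eventually, rule allI)
    fix n
    have "real (Suc n) ^ 3 * (1 - Q n) \<le> real (Suc n) ^ 4 * (1 - Q n)"
      using Q(2)[of n] by (intro mult_right_mono power_increasing) auto
    then show "norm (real (Suc n) ^ 3 * (1 - Q n)) \<le> real (Suc n) ^ 4 * (1 - Q n)"
      using Q(2)[of n] by (simp add: abs_mult)
  qed
  have one: "(\<lambda>n. real n * (1 - Q n)) \<longlonglongrightarrow> 0"
  proof (rule Lim_null_comparison[OF _ four], rule always_eventually, rule allI)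
    fix n
    have "real n \<le> real (Suc n) ^ 1" by simp
    also have "\<dots> \<le> real (Suc n) ^ 4" by (rule power_increasing) auto
    finally have "real n * (1 - Q n) \<le> real (Suc n) ^ 4 * (1 - Q n)"
      using Q(2)[of n] by (intro mult_right_mono) auto
    then show "norm (real n * (1 - Q n)) \<le> real (Suc n) ^ 4 * (1 - Q n)"
      using Q(2)[of n] by (simp add: abs_mult)
  qed
  have "continuous_on {0..1} f"
    using assms(3) by (meson DERIV_continuous continuous_on_eq_continuous_within)
  then have "compact (f ` {0..1})" by (intro compact_continuous_image) auto
  then obtain B where B: "\<And>t. 0 \<le> t \<Longrightarrow> t \<le> 1 \<Longrightarrow> \<bar>f t\<bar> \<le> B"
    by (force dest!: compact_imp_bounded simp: bounded_iff)
  have e3: "0 < e / 3" using e by simp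
  obtain N where N: "\<And>n x. N \<le> n \<Longrightarrow> x \<in> {0..1} \<Longrightarrow>
      \<bar>f' x - (\<Sum>k\<le>n. f' (real k / real n) * Bernstein n k x)\<bar> < e / 3"
    using Bernstein_Weierstrass[OF assms(4) e3] by blast
  have "(\<lambda>n. 2 * B * (real (Suc n) ^ 3 * (1 - Q n))) \<longlonglongrightarrow> 2 * B * 0"
    by (intro tendsto_mult tendsto_const three)
  then have "\<forall>\<^sub>F n in sequentially. 2 * B * (real (Suc n) ^ 3 * (1 - Q n)) < e / 3"
    using e3 by (intro order_tendstoD(2)) auto
  moreover have "\<forall>\<^sub>F n in sequentially. \<forall>k\<le>n. \<bar>coeff_slope n k (Q n) \<alpha> \<beta> f - f' (real k / real n)\<bar> < e / 3"
    by (rule eventually_all_le_if_sequences[OF _ e3], rule coeff_slope_asymp[OF Q one])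
      (use assms in auto)
  moreover have "\<forall>\<^sub>F n in sequentially. N \<le> n" by (rule eventually_ge_at_top)
  ultimately have "\<forall>\<^sub>F n in sequentially. \<forall>x\<in>{0..1}.
     dist (deriv (q_durrmeyer (Suc n) (q (Suc n)) \<alpha> \<beta> f) x) (f' x) < e"
  proof eventually_elim
    case (elim n)
    show ?case
    proof
      fix x :: real assume x: "x \<in> {0..1}"
      let ?S = "\<Sum>k\<le>n. coeff_slope n k (Q n) \<alpha> \<beta> f * Bernstein n k x"
      let ?T = "\<Sum>k\<le>n. f' (real k / real n) * Bernstein n k x"
      have "\<bar>deriv (q_durrmeyer (Suc n) (Q n) \<alpha> \<beta> f) x - ?S\<bar> \<le> 2 * B * (1 - Q n) * real (Suc n) ^ 3"
        by (rule deriv_q_durrmeyer_approx[OF Q assms(1,2) _ _ B]) (use x in auto)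
      also have "\<dots> = 2 * B * (real (Suc n) ^ 3 * (1 - Q n))" by (simp only: mult_ac)
      also have "\<dots> < e / 3" by (rule elim(1))
      finally have 1: "\<bar>deriv (q_durrmeyer (Suc n) (Q n) \<alpha> \<beta> f) x - ?S\<bar> < e / 3" .
      have "?S - ?T = (\<Sum>k\<le>n. (coeff_slope n k (Q n) \<alpha> \<beta> f - f' (real k / real n)) * Bernstein n k x)"
        by (simp add: sum_subtractf left_diff_distrib)
      also have "\<bar>\<dots>\<bar> \<le> (\<Sum>k\<le>n. e / 3 * Bernstein n k x)"
      proof (rule order_trans[OF sum_abs sum_mono])
        fix k assume "k \<in> {..n}"
        then have "\<bar>coeff_slope n k (Q n) \<alpha> \<beta> f - f' (real k / real n)\<bar> \<le> e / 3"
          using elim(2) by (simp add: less_imp_le)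
        moreover have "0 \<le> Bernstein n k x" using x by (simp add: Bernstein_nonneg)
        ultimately show "\<bar>(coeff_slope n k (Q n) \<alpha> \<beta> f - f' (real k / real n)) * Bernstein n k x\<bar>
            \<le> e / 3 * Bernstein n k x"
          by (simp only: abs_mult abs_of_nonneg mult_right_mono)
      qed
      also have "\<dots> = e / 3" by (simp only: sum_distrib_left[symmetric] sum_Bernstein mult_1_right)
      finally have 2: "\<bar>?S - ?T\<bar> \<le> e / 3" .
      show "dist (deriv (q_durrmeyer (Suc n) (q (Suc n)) \<alpha> \<beta> f) x) (f' x) < e"
        using 1 2 N[OF elim(3) x] unfolding dist_real_def Q_def[symmetric] by linarith
    qed
  qed
  then show "\<forall>\<^sub>F n in sequentially. \<forall>x\<in>{0..1}. dist (deriv (q_durrmeyer n (q n) \<alpha> \<beta> f) x) (f' x) < e"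
    by (rule eventually_sequentially_Suc[THEN iffD1])
qed

end
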